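(* Let $(q_i)_{i=1,\ldots,4}$ and $(b^\alpha)_{\alpha=1,\ldots,4}$ be two quadruples of smooth quadrics in $P_3=P_3(\mathbb{C})$ forming a double-four configuration, that is: the $q_i$ are linearly independent and each $q_i$ is a common basket for $b^1,\ldots,b^4$; and the $b^\alpha$ are linearly independent and each $b^\alpha$ is a common basket for $q_1,\ldots,q_4$. Then there is a projective automorphism of $P_3$ which carries the two quadruples $(q_i)_i$ and $(b^\alpha)_\alpha$ to the standard double-four configuration.
   Context: Quadric surfaces in $P_3(\mathbb{C})$ are identified with points of $P_9=P(\mathrm{Sym}_{\mathbb{C}}(4))$ (complex symmetric $4\times4$ matrices up to scale); linear independence of quadrics refers to their matrices. Basket: for distinct quadric surfaces $q_1,q_2$ of rank at least three, $q_1$ is a basket for $q_2$ (and vice versa) when they are tangent along a conic, so that their intersection is twice this conic. Whenever one speaks of a common basket for several quadrics, all quadrics concerned are assumed distinct and of rank at least three. Standard double-four configuration: the eight diagonal quadrics $\pm x_1^2\pm x_2^2\pm x_3^2\pm x_4^2$ (up to overall sign), separated into two groups of four according to the sign of the determinant. One group is $(\sum_{j=1}^4x_j^2)-2x_i^2$, $i=1,\ldots,4$ (negative determinant); the other group is $\sum_{j=1}^4x_j^2$ and $(\sum_{j=1}^4x_j^2)-2(x_\beta^2+x_{\beta-1}^2)$ for $\beta=2,3,4$ (positive determinant; here the case $\beta$ can be read up to the overall sign and relabelling as the three quadrics with exactly two minus signs). To carry a double-four to the standard one means to carry the two (unordered) quadruples to the two (unordered) groups above; neither the indexing within the quadruples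 nor which quadruple goes to which group is prescribed. *)

theory Defs
  imports "HOL-Analysis.Analysis"
begin

text \<open>
  The library's inner product on \<^typ>\<open>complex ^ 4\<close> is Hermitian and real-valued; the bilinear
  pairing is needed here. Points of projective 3-space are given by nonzero vectors of homogeneous
  coordinates, so subsets of the space appear as cones with the origin removed.
\<close>

definition bil :: "complex ^ 4 \<Rightarrow> complex ^ 4 \<Rightarrow> complex" where
  "bil x y = (\<Sum>i\<in>UNIV. x $ i * y $ i)"

definition qform :: "complex ^ 4 ^ 4 \<Rightarrow> complex ^ 4 \<Rightarrow> complex" where
  "qform A x = bil x (A *v x)"

definition locus :: "complex ^ 4 ^ 4 \<Rightarrow> (complex ^ 4) set" where
  "locus A = {x. x \<noteq> 0 \<and> qform A x = 0}"

definition mscale :: "complex \<Rightarrow> complex ^ 4 ^ 4 \<Rightarrow> complex ^ 4 ^ 4" where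
  "mscale c A = (\<chi> i j. c * A $ i $ j)"

definition is_quadric :: "complex ^ 4 ^ 4 \<Rightarrow> bool" where
  "is_quadric A \<longleftrightarrow> A \<noteq> 0 \<and> transpose A = A"

text \<open>
  The point of the projective space of symmetric matrices represented by a matrix. Two quadrics
  are equal when these points are.
\<close>

definition quadric_pt :: "complex ^ 4 ^ 4 \<Rightarrow> (complex ^ 4 ^ 4) set" where
  "quadric_pt A = {mscale c A | c. c \<noteq> 0}"

text \<open>For symmetric \<open>A\<close> the gradient of \<open>qform A\<close> at \<open>x\<close> is \<open>2 (A *v x)\<close>.\<close>

definition smooth_quadric :: "complex ^ 4 ^ 4 \<Rightarrow> bool" where
  "smooth_quadric A \<longleftrightarrow> is_quadric A \<and> (\<forall>x\<in>locus A. A *v x \<noteq> 0)"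

text \<open>The tangent plane at a smooth point, the whole space at a singular one.\<close>

definition tangent_space :: "complex ^ 4 ^ 4 \<Rightarrow> complex ^ 4 \<Rightarrow> (complex ^ 4) set" where
  "tangent_space A x = {y. bil (A *v x) y = 0}"

definition plane :: "complex ^ 4 \<Rightarrow> (complex ^ 4) set" where
  "plane h = {x. x \<noteq> 0 \<and> bil h x = 0}"

text \<open>
  A conic is the zero set, in a plane, of a quadratic form that does not vanish identically on
  this plane. Degenerate conics are included.
\<close>

definition is_conic :: "(complex ^ 4) set \<Rightarrow> bool" where
  "is_conic C \<longleftrightarrow> (\<exists>h S. h \<noteq> 0 \<and> is_quadric S \<and> \<not> plane h \<subseteq> locus S \<and> C = plane h \<inter> locus S)"

text \<open>
  Tangency along a conic which is the whole intersection. By Bezout, this says that the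
  intersection, a curve of degree four, is twice the conic.
\<close>

definition basket :: "complex ^ 4 ^ 4 \<Rightarrow> complex ^ 4 ^ 4 \<Rightarrow> bool" where
  "basket A B \<longleftrightarrow>
     is_quadric A \<and> is_quadric B \<and> rank A \<ge> 3 \<and> rank B \<ge> 3 \<and> quadric_pt A \<noteq> quadric_pt B \<and>
     (\<exists>C. is_conic C \<and> locus A \<inter> locus B = C \<and>
          (\<forall>x\<in>C. tangent_space A x = tangent_space B x))"

definition common_basket :: "complex ^ 4 ^ 4 \<Rightarrow> (4 \<Rightarrow> complex ^ 4 ^ 4) \<Rightarrow> bool" where
  "common_basket A B \<longleftrightarrow> inj (\<lambda>\<alpha>. quadric_pt (B \<alpha>)) \<and> (\<forall>\<alpha>. basket A (B \<alpha>))"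

definition lin_indep :: "(4 \<Rightarrow> complex ^ 4 ^ 4) \<Rightarrow> bool" where
  "lin_indep q \<longleftrightarrow> (\<forall>c. (\<Sum>i\<in>UNIV. mscale (c i) (q i)) = 0 \<longrightarrow> (\<forall>i. c i = 0))"

definition double_four :: "(4 \<Rightarrow> complex ^ 4 ^ 4) \<Rightarrow> (4 \<Rightarrow> complex ^ 4 ^ 4) \<Rightarrow> bool" where
  "double_four q b \<longleftrightarrow>
     lin_indep q \<and> (\<forall>i. common_basket (q i) b) \<and>
     lin_indep b \<and> (\<forall>\<alpha>. common_basket (b \<alpha>) q)"

text \<open>
  The image of a quadric under the projective automorphism \<open>x \<mapsto> P *v x\<close>, see lemma
  \<open>locus_image_quadric\<close>.
\<close>

definition image_quadric :: "complex ^ 4 ^ 4 \<Rightarrow> complex ^ 4 ^ 4 \<Rightarrow> complex ^ 4 ^ 4" where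
  "image_quadric P A = transpose (matrix_inv P) ** A ** matrix_inv P"

definition diag :: "complex ^ 4 \<Rightarrow> complex ^ 4 ^ 4" where
  "diag s = (\<chi> i j. if i = j then s $ i else 0)"

text \<open>
  The diagonal quadrics with signs \<open>\<plusminus>1\<close> and determinant \<open>\<epsilon>\<close>. The determinant is
  unaffected by an overall sign, and \<open>std_group (- 1)\<close> and \<open>std_group 1\<close> are the two groups
  of the standard double-four, listed in \<open>std_group_neg\<close> and \<open>std_group_pos\<close>.
\<close>

definition std_group :: "complex \<Rightarrow> (complex ^ 4 ^ 4) set set" where
  "std_group \<epsilon> = {quadric_pt (diag s) | s. (\<forall>i. s $ i \<in> {1, -1}) \<and> det (diag s) = \<epsilon>}"

lemma bil_transpose: "bil x (transpose A *v y) = bil (A *v x) y"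
  unfolding bil_def matrix_vector_mult_def transpose_def
  by (simp add: sum_distrib_left sum_distrib_right)
     (subst sum.swap, simp add: mult_ac)

lemma qform_image_quadric: "qform (image_quadric P A) x = qform A (matrix_inv P *v x)"
  unfolding qform_def image_quadric_def matrix_vector_mul_assoc [symmetric] bil_transpose ..

lemma locus_image_quadric:
  assumes "invertible P"
  shows "locus (image_quadric P A) = (\<lambda>x. P *v x) ` locus A"
proof -
  have "P ** matrix_inv P = mat 1 \<and> matrix_inv P ** P = mat 1"
    using assms unfolding invertible_def matrix_inv_def by (rule someI_ex)
  then have 1: "P *v (matrix_inv P *v x) = x" "matrix_inv P *v (P *v x) = x" for x
    by (simp_all add: matrix_vector_mul_assoc)
  have 2: "P *v x \<noteq> 0 \<longleftrightarrow> x \<noteq> 0" for x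
    using 1(2) [of x] by (metis matrix_vector_mult_0_right)
  have 3: "P *v x \<in> locus (image_quadric P A) \<longleftrightarrow> x \<in> locus A" for x
    unfolding locus_def mem_Collect_eq qform_image_quadric 1 2 ..
  show ?thesis
  proof (intro equalityI subsetI)
    fix x assume "x \<in> locus (image_quadric P A)"
    then have "matrix_inv P *v x \<in> locus A"
      using 3 [of "matrix_inv P *v x"] unfolding 1 by blast
    then have "P *v (matrix_inv P *v x) \<in> (\<lambda>x. P *v x) ` locus A"
      by (rule imageI)
    then show "x \<in> (\<lambda>x. P *v x) ` locus A"
      unfolding 1 .
  next
    fix y assume "y \<in> (\<lambda>x. P *v x) ` locus A"
    then show "y \<in> locus (image_quadric P A)"
      using 3 by blast
  qed
qed

lemma det_diag: "det (diag s) = s $ 1 * s $ 2 * s $ 3 * s $ 4"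
proof -
  have "det (diag s) = (\<Prod>i\<in>UNIV. diag s $ i $ i)"
    by (rule det_diagonal) (simp add: diag_def)
  then show ?thesis unfolding UNIV_4 by (simp add: diag_def)
qed

lemma quadric_pt_diag_uminus: "quadric_pt (diag (- s)) = quadric_pt (diag s)"
proof -
  have *: "mscale c (diag (- s)) = mscale (- c) (diag s)" for c s
    by (simp add: mscale_def diag_def vec_eq_iff)
  have "quadric_pt (diag (- s)) \<subseteq> quadric_pt (diag s)" for s
  proof
    fix M assume "M \<in> quadric_pt (diag (- s))"
    then obtain c where "c \<noteq> 0" "M = mscale (- c) (diag s)"
      unfolding quadric_pt_def * by blast
    then show "M \<in> quadric_pt (diag s)"
      unfolding quadric_pt_def by (intro CollectI exI [of _ "- c"]) simp
  qed
  from this [of s] this [of "- s"] show ?thesis by simp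
qed

lemma sgn_prod_neg:
  fixes a b c d :: complex
  assumes "a \<in> {1, -1}" "b \<in> {1, -1}" "c \<in> {1, -1}" "d \<in> {1, -1}" "a * b * c * d = - 1"
  shows "(a = - b \<and> c = b \<and> d = b) \<or> (b = - a \<and> c = a \<and> d = a)
    \<or> (c = - a \<and> b = a \<and> d = a) \<or> (d = - a \<and> b = a \<and> c = a)"
  using assms unfolding insert_iff empty_iff by (elim disjE) simp_all
lemma sgn_prod_pos:
  fixes a b c d :: complex
  assumes "a \<in> {1, -1}" "b \<in> {1, -1}" "c \<in> {1, -1}" "d \<in> {1, -1}" "a * b * c * d = 1"
  shows "(b = a \<and> c = a \<and> d = a) \<or> (b = a \<and> c = - a \<and> d = - a)
    \<or> (c = a \<and> b = - a \<and> d = - a) \<or> (d = a \<and> b = - a \<and> c = - a)"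
  using assms unfolding insert_iff empty_iff by (elim disjE) simp_all
lemma std_group_neg:
  "std_group (- 1) = range (\<lambda>i. quadric_pt (diag (\<chi> j. if j = i then - 1 else 1)))"
    (is "_ = range (\<lambda>i. quadric_pt (diag (?e i)))")
proof (intro equalityI subsetI)
  fix Q assume "Q \<in> std_group (- 1)"
  then obtain s where s: "\<forall>i. s $ i \<in> {1, -1}" "det (diag s) = - 1" and Q: "Q = quadric_pt (diag s)"
    unfolding std_group_def by blast
  have *: "s = ?e i \<or> - s = ?e i"
    if "c \<in> {1, -1}" "\<forall>j. s $ j = (if j = i then - c else c)" for i c
  proof -
    have "c = 1 \<or> c = - 1" using that(1) by simp
    then show ?thesis using that(2) unfolding vec_eq_iff by (elim disjE) simp_all
  qed
  have "(\<forall>j. s $ j = (if j = 1 then - s $ 2 else s $ 2)) \<or> (\<forall>j. s $ j = (if j = 2 then - s $ 1 else s $ 1))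
    \<or> (\<forall>j. s $ j = (if j = 3 then - s $ 1 else s $ 1)) \<or> (\<forall>j. s $ j = (if j = 4 then - s $ 1 else s $ 1))"
    using sgn_prod_neg [of "s $ 1" "s $ 2" "s $ 3" "s $ 4"] s unfolding det_diag forall_4 by simp blast
  then obtain i where "s = ?e i \<or> - s = ?e i"
    using * s(1) by meson
  then have "quadric_pt (diag s) = quadric_pt (diag (?e i))"
    using quadric_pt_diag_uminus [of s] by (elim disjE) simp_all
  then show "Q \<in> range (\<lambda>i. quadric_pt (diag (?e i)))"
    unfolding Q by (rule range_eqI)
next
  fix Q :: "(complex ^ 4 ^ 4) set"
  assume "Q \<in> range (\<lambda>i. quadric_pt (diag (?e i)))"
  then obtain i where Q: "Q = quadric_pt (diag (?e i))" by (elim rangeE)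
  have "(if 1 = i then - 1 else 1) * (if 2 = i then - 1 else 1) * (if 3 = i then - 1 else 1)
      * (if 4 = i then - 1 else 1 :: complex) = - 1"
    using exhaust_4 [of i] by (elim disjE; hypsubst) simp_all
  then have "det (diag (?e i)) = - 1" unfolding det_diag vec_lambda_beta .
  moreover have "\<forall>j. ?e i $ j \<in> {1, -1}" by simp
  ultimately show "Q \<in> std_group (- 1)"
    unfolding Q std_group_def by blast
qed

lemma std_group_pos:
  "std_group 1 = insert (quadric_pt (diag (\<chi> j. 1)))
     ((\<lambda>k. quadric_pt (diag (\<chi> j. if j = 1 \<or> j = k then - 1 else 1))) ` {2, 3, 4})"
    (is "_ = insert (quadric_pt (diag ?u)) ((\<lambda>k. quadric_pt (diag (?e k))) ` _)")
proof (intro equalityI subsetI)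
  fix Q assume "Q \<in> std_group 1"
  then obtain s where s: "\<forall>i. s $ i \<in> {1, -1}" "det (diag s) = 1" and Q: "Q = quadric_pt (diag s)"
    unfolding std_group_def by blast
  have pt: "Q = quadric_pt (diag e)" if "s = e \<or> - s = e" for e
    using that quadric_pt_diag_uminus [of s] unfolding Q by (elim disjE) simp_all
  have u: "s = ?u \<or> - s = ?u" if *: "\<forall>j. s $ j = s $ 1"
  proof -
    have "s $ 1 = 1 \<or> s $ 1 = - 1" using s(1) by simp
    then obtain c where "c = 1 \<or> c = - 1" "\<forall>j. s $ j = c" using * by metis
    then show ?thesis unfolding vec_eq_iff by (elim disjE) simp_all
  qed
  have e: "s = ?e k \<or> - s = ?e k" if *: "\<forall>j. s $ j = (if j = 1 \<or> j = k then s $ 1 else - s $ 1)" for k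
  proof -
    have "s $ 1 = 1 \<or> s $ 1 = - 1" using s(1) by simp
    then obtain c where "c = 1 \<or> c = - 1" "\<forall>j. s $ j = (if j = 1 \<or> j = k then c else - c)"
      using * by metis
    then show ?thesis unfolding vec_eq_iff by (elim disjE) simp_all
  qed
  have "(\<forall>j. s $ j = s $ 1) \<or> (\<exists>k\<in>{2, 3, 4}. \<forall>j. s $ j = (if j = 1 \<or> j = k then s $ 1 else - s $ 1))"
    using sgn_prod_pos [of "s $ 1" "s $ 2" "s $ 3" "s $ 4"] s unfolding det_diag forall_4 by simp blast
  then show "Q \<in> insert (quadric_pt (diag ?u)) ((\<lambda>k. quadric_pt (diag (?e k))) ` {2, 3, 4})"
  proof
    assume "\<forall>j. s $ j = s $ 1"
    from pt [OF u [OF this]] show ?thesis by (rule iffD2 [OF insert_iff, OF disjI1])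
  next
    assume "\<exists>k\<in>{2, 3, 4}. \<forall>j. s $ j = (if j = 1 \<or> j = k then s $ 1 else - s $ 1)"
    then obtain k where k: "k \<in> {2, 3, 4}"
      and "\<forall>j. s $ j = (if j = 1 \<or> j = k then s $ 1 else - s $ 1)" by (elim bexE)
    from pt [OF e [OF this(2)]] show ?thesis by (intro insertI2 image_eqI [OF _ k])
  qed
next
  fix Q :: "(complex ^ 4 ^ 4) set"
  assume "Q \<in> insert (quadric_pt (diag ?u)) ((\<lambda>k. quadric_pt (diag (?e k))) ` {2, 3, 4})"
  then show "Q \<in> std_group 1"
    unfolding insert_iff [of Q]
  proof (elim disjE imageE)
    assume Q: "Q = quadric_pt (diag ?u)"
    have "det (diag ?u) = 1" unfolding det_diag by simp
    moreover have "\<forall>j. ?u $ j \<in> {1, -1}" by simp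
    ultimately show ?thesis unfolding Q std_group_def by blast
  next
    fix k :: 4
    assume Q: "Q = quadric_pt (diag (?e k))" and k: "k \<in> {2, 3, 4}"
    have "k = 2 \<or> k = 3 \<or> k = 4" using k by (simp only: insert_iff empty_iff simp_thms)
    then have "(if 1 = (1::4) \<or> 1 = k then - 1 else 1) * (if 2 = (1::4) \<or> 2 = k then - 1 else 1)
      * (if 3 = (1::4) \<or> 3 = k then - 1 else 1) * (if 4 = (1::4) \<or> 4 = k then - 1 else 1 :: complex) = 1"
      by (elim disjE; hypsubst) simp_all
    then have "det (diag (?e k)) = 1" unfolding det_diag vec_lambda_beta .
    moreover have "\<forall>j. ?e k $ j \<in> {1, -1}" by simp
    ultimately show ?thesis unfolding Q std_group_def by blast
  qed
qed

end

theory Submission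
  imports Defs
begin

text \<open>
  Two smooth quadrics \<open>A\<close>, \<open>B\<close> are tangent along a conic iff \<open>B = c A + h h\<^sup>T\<close> for some \<open>c, h \<noteq> 0\<close>. So
  \<open>b\<^sup>m = c\<^sub>i\<^sub>m q\<^sub>i + h\<^sub>i\<^sub>m h\<^sub>i\<^sub>m\<^sup>T\<close>. If \<open>c\<^sub>i\<^sub>m / c\<^sub>i\<^sub>n\<close> did not depend on \<open>i\<close>, the four \<open>q\<^sub>i\<close> would lie in a space of
  dimension three. Hence for \<open>m \<noteq> n\<close> two of these ratios differ, and eliminating the corresponding
  \<open>q\<^sub>i\<close> writes \<open>q\<^sub>1\<close> as a combination of four squares, two of them those of \<open>h\<^sub>1\<^sub>m\<close> and \<open>h\<^sub>1\<^sub>n\<close>. Thus the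
  \<open>h\<^sub>1\<^sub>m\<close> are orthogonal for \<open>q\<^sub>1\<^sup>-\<^sup>1\<close>, and the numbers \<open>x\<^sub>m = 1 + q\<^sub>1\<^sup>-\<^sup>1(h\<^sub>1\<^sub>m) / c\<^sub>1\<^sub>m\<close> satisfy \<open>x\<^sub>m \<noteq> 1\<close> and
  \<open>x\<^sub>m x\<^sub>n = 1\<close> for \<open>m \<noteq> n\<close>, which forces \<open>x\<^sub>m = -1\<close>; moreover
  \<open>c\<^sub>i\<^sub>m / c\<^sub>1\<^sub>m\<close> is independent of \<open>m\<close> up to sign. In coordinates adapted to the \<open>h\<^sub>1\<^sub>m\<close> the quadric
  \<open>q\<^sub>1\<close> is the sum of squares, the \<open>b\<^sup>m\<close> are the standard quadrics of determinant \<open>-1\<close>, and a quadric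
  having these four as baskets with such ratios is diagonal with signs of determinant \<open>1\<close>.
\<close>

section \<open>Linear forms and squares of linear forms\<close>

definition outer :: "complex ^ 4 \<Rightarrow> complex ^ 4 ^ 4" where
  "outer h = (\<chi> i j. h $ i * h $ j)"

lemma bil_commute: "bil x y = bil y x"
  by (simp add: bil_def mult.commute)

lemma bil_add [simp]: "bil (x + y) z = bil x z + bil y z" "bil z (x + y) = bil z x + bil z y"
  by (simp_all add: bil_def algebra_simps sum.distrib)

lemma bil_diff [simp]: "bil (x - y) z = bil x z - bil y z" "bil z (x - y) = bil z x - bil z y"
  by (simp_all add: bil_def algebra_simps sum_subtractf)

lemma bil_uminus [simp]: "bil (- x) y = - bil x y" "bil x (- y) = - bil x y"
  by (simp_all add: bil_def sum_negf)

lemma bil_scale [simp]: "bil (c *s x) z = c * bil x z" "bil z (c *s x) = c * bil z x"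
  by (simp_all add: bil_def sum_distrib_left mult_ac)

lemma bil_zero [simp]: "bil 0 x = 0" "bil x 0 = 0"
  by (simp_all add: bil_def)

lemma bil_axis: "bil h (axis i 1) = h $ i"
  by (simp add: bil_def axis_def if_distrib cong: if_cong)

lemma bil_axis_left: "bil (axis i 1) h = h $ i"
  by (simp add: bil_commute [of _ h] bil_axis)

lemma bil_symmetric: "transpose A = A \<Longrightarrow> bil x (A *v y) = bil (A *v x) y"
  using bil_transpose [of x A y] by simp

lemma mscale_mv [simp]: "mscale c A *v x = c *s (A *v x)"
  by (simp add: mscale_def matrix_vector_mult_def vec_eq_iff sum_distrib_left mult_ac)

lemma outer_mv: "outer h *v x = bil h x *s h"
  by (simp add: outer_def bil_def matrix_vector_mult_def vec_eq_iff sum_distrib_left mult_ac)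

lemma outer_eq_0_iff [simp]: "outer h = 0 \<longleftrightarrow> h = 0"
  by (auto simp: outer_def vec_eq_iff)

text \<open>Repeating the third form as a fourth row makes the matrix singular. Repeated arguments
  cover the case of fewer forms.\<close>

lemma exists_common_zero:
  obtains x where "x \<noteq> 0" "bil a x = 0" "bil b x = 0" "bil c x = 0"
proof -
  define M :: "complex ^ 4 ^ 4" where "M = (\<chi> i. if i = 1 then a else if i = 2 then b else c)"
  have "row 3 M = row 4 M" by (simp add: row_def M_def vec_eq_iff)
  then have "det M = 0" by (rule det_identical_rows [rotated]) simp
  then have "\<not> invertible M" by (simp add: invertible_det_nz)
  then obtain x where x: "x \<noteq> 0" "M *v x = 0"
    unfolding invertible_left_inverse matrix_left_invertible_ker by blast
  have *: "bil (M $ i) x = 0" for i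
    using x(2) by (simp add: matrix_vector_mult_def bil_def vec_eq_iff)
  show thesis
    using that [of x] x(1) * [of 1] * [of 2] * [of 3] by (simp add: M_def)
qed

text \<open>If \<open>k $ j\<close> is nonzero, the vectors
  \<open>axis i 1 - (k $ i / k $ j) *s axis j 1\<close> lie in the kernel of \<open>k\<close>, and
  evaluating \<open>h\<close> on them determines \<open>h $ i\<close> from
  \<open>h $ j\<close>.\<close>

lemma parallel_if_ker_subset:
  assumes "\<And>x. bil k x = 0 \<Longrightarrow> bil h x = 0"
  obtains c where "h = c *s k"
proof (cases "k = 0")
  case True
  then have "h $ i = 0" for i using assms [of "axis i 1"] by (simp add: bil_axis)
  then show thesis using that [of 0] by (simp add: vec_eq_iff)
next
  case False
  then obtain j where j: "k $ j \<noteq> 0" by (auto simp: vec_eq_iff)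
  have "h $ i = h $ j / k $ j * k $ i" for i
  proof -
    have "bil k (axis i 1 - (k $ i / k $ j) *s axis j 1) = 0" using j by (simp add: bil_axis)
    then have "bil h (axis i 1 - (k $ i / k $ j) *s axis j 1) = 0" by (rule assms)
    then show ?thesis by (simp add: bil_axis)
  qed
  then have "h = (h $ j / k $ j) *s k" unfolding vec_eq_iff vector_smult_component by blast
  then show thesis by (rule that)
qed

lemma exists_separating:
  assumes "\<And>c. h \<noteq> c *s k"
  obtains x where "bil h x = 1" "bil k x = 0"
proof -
  have "\<exists>y. bil k y = 0 \<and> bil h y \<noteq> 0"
  proof (rule ccontr)
    assume "\<not> ?thesis"
    then have "bil h y = 0" if "bil k y = 0" for y using that by blast
    from parallel_if_ker_subset [OF this] obtain c where "h = c *s k" by blast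
    with assms show False by blast
  qed
  then obtain y where "bil k y = 0" "bil h y \<noteq> 0" by blast
  then show thesis using that [of "(1 / bil h y) *s y"] by simp
qed

section \<open>Smooth quadrics and the projective points they represent\<close>

lemma smooth_quadric_symmetric: "smooth_quadric A \<Longrightarrow> transpose A = A"
  by (simp add: smooth_quadric_def is_quadric_def)

lemma smooth_quadric_ker:
  assumes "smooth_quadric A" "A *v x = 0"
  shows "x = 0"
  using assms by (auto simp: smooth_quadric_def locus_def qform_def)

lemma smooth_quadric_invertible: "smooth_quadric A \<Longrightarrow> invertible A"
  unfolding invertible_left_inverse matrix_left_invertible_ker using smooth_quadric_ker by blast

lemma quadric_pt_mscale:
  assumes "c \<noteq> 0"
  shows "quadric_pt (mscale c A) = quadric_pt A"
proof (intro equalityI subsetI)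
  have assoc: "mscale d (mscale e A) = mscale (d * e) A" for d e by (simp add: mscale_def mult.assoc)
  fix M
  show "M \<in> quadric_pt A" if "M \<in> quadric_pt (mscale c A)"
    using that assms by (auto simp: quadric_pt_def assoc)
  assume "M \<in> quadric_pt A"
  then obtain d where "d \<noteq> 0" "M = mscale (d / c) (mscale c A)"
    using assms by (auto simp: quadric_pt_def assoc)
  then show "M \<in> quadric_pt (mscale c A)"
    unfolding quadric_pt_def using assms by (intro CollectI exI [of _ "d / c"]) simp
qed

lemma quadric_pt_eqD:
  assumes "quadric_pt A = quadric_pt B"
  obtains c where "c \<noteq> 0" "A = mscale c B"
proof -
  have "mscale 1 A = A" by (simp add: mscale_def vec_eq_iff)
  then have "A \<in> quadric_pt A"
    unfolding quadric_pt_def by (intro CollectI exI [of _ 1]) simp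
  then show thesis using that unfolding assms by (auto simp: quadric_pt_def)
qed

subsection \<open>Tangency along a conic\<close>

text \<open>
  At a common point \<open>x\<close> the tangent planes of \<open>A\<close> and \<open>B\<close> agree iff \<open>x\<close> is an eigenvector of the
  pencil spanned by \<open>A\<close> and \<open>B\<close>.
\<close>

definition eigen :: "complex ^ 4 ^ 4 \<Rightarrow> complex ^ 4 ^ 4 \<Rightarrow> complex \<Rightarrow> complex ^ 4 \<Rightarrow> bool" where
  "eigen A B l x \<longleftrightarrow> B *v x = l *s (A *v x)"

lemma tangent_eigen:
  assumes "tangent_space A x = tangent_space B x"
  obtains l where "eigen A B l x"
proof (rule parallel_if_ker_subset [of "A *v x" "B *v x"])
  show "bil (B *v x) y = 0" if "bil (A *v x) y = 0" for y
    using assms that by (auto simp: tangent_space_def)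
qed (use that in \<open>unfold eigen_def, blast\<close>)

lemma eigen_add: "eigen A B l x \<Longrightarrow> eigen A B l y \<Longrightarrow> eigen A B l (x + y)"
  by (simp add: eigen_def matrix_vector_right_distrib)

lemma eigen_scale: "eigen A B l x \<Longrightarrow> eigen A B l (c *s x)"
  by (simp add: eigen_def vector_scalar_commute mult_ac)

text \<open>Expanding \<open>B *v (x + y)\<close> in two ways puts
  \<open>(n - l) *s x + (n - m) *s y\<close> into the kernel of \<open>A\<close>, so independence
  gives \<open>l = n = m\<close>.\<close>

lemma eigen_add_same:
  assumes ker: "\<And>x. A *v x = 0 \<Longrightarrow> x = 0"
    and "eigen A B l x" "eigen A B m y" "eigen A B n (x + y)"
    and indep: "\<And>s t. s *s x + t *s y = 0 \<Longrightarrow> s = 0 \<and> t = 0"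
  shows "l = m"
proof -
  have "A *v ((n - l) *s x + (n - m) *s y) = n *s (A *v (x + y)) - (l *s (A *v x) + m *s (A *v y))"
    by (simp add: vector_scalar_commute algebra_simps)
  also have "n *s (A *v (x + y)) = B *v x + B *v y"
    using assms(4) by (simp only: eigen_def matrix_vector_right_distrib)
  also have "\<dots> - (l *s (A *v x) + m *s (A *v y)) = 0"
    using assms(2,3) by (simp only: eigen_def diff_self)
  finally have "(n - l) *s x + (n - m) *s y = 0" by (rule ker)
  from indep [OF this] show ?thesis by (metis right_minus_eq)
qed

lemma binary_quadratic_zero:
  fixes a b c :: complex
  obtains s t where "s \<noteq> 0 \<or> t \<noteq> 0" "s\<^sup>2 * a + 2 * s * t * b + t\<^sup>2 * c = 0"
proof (cases "a = 0")
  case True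
  then show thesis using that [of 1 0] by simp
next
  case False
  \<comment> \<open>A square root of a quarter of the discriminant; the zero is then
    \<open>(d - b, a)\<close>.\<close>
  define d where "d = csqrt (b\<^sup>2 - a * c)"
  have d: "d\<^sup>2 = b\<^sup>2 - a * c" by (simp add: d_def)
  have "(d - b)\<^sup>2 * a + 2 * (d - b) * a * b + a\<^sup>2 * c = a * (d\<^sup>2 - b\<^sup>2 + a * c)"
    by (simp add: power2_eq_square algebra_simps)
  then show thesis using that [of "d - b" a] False d by simp
qed

lemma qform_add:
  assumes "transpose A = A"
  shows "qform A (x + y) = qform A x + 2 * bil (A *v x) y + qform A y"
proof -
  have "bil y (A *v x) = bil (A *v x) y" "bil x (A *v y) = bil (A *v x) y"
    using bil_symmetric [OF assms, of x y] bil_commute [of y "A *v x"] by simp_all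
  then show ?thesis by (simp add: qform_def matrix_vector_right_distrib)
qed

lemma matrix_vector_mult_uminus: "A *v (- x) = - (A *v x)" for x :: "complex ^ 4"
  using matrix_vector_mult_diff_distrib [of A 0 x] by simp

lemma qform_uminus [simp]: "qform A (- x) = qform A x"
  by (simp add: qform_def matrix_vector_mult_uminus)

lemma qform_scale: "qform A (c *s x) = c\<^sup>2 * qform A x"
  by (simp add: qform_def vector_scalar_commute power2_eq_square)

text \<open>
  This excludes conics that are double lines: a smooth quadric \<open>A\<close> and a quadric \<open>N\<close> singular along
  a line of \<open>A\<close> meet outside this line as well.
\<close>

lemma common_zero_off_line:
  assumes A: "transpose A = A" and N: "transpose N = N" and ker: "\<And>x. A *v x = 0 \<Longrightarrow> x = 0"
    and p: "bil h p = 1" "bil g p = 0" and q: "bil h q = 0" "bil g q = 1"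
    and isotropic: "\<And>x. bil h x = 0 \<Longrightarrow> bil g x = 0 \<Longrightarrow> qform A x = 0"
    and kernel: "\<And>x. bil h x = 0 \<Longrightarrow> bil g x = 0 \<Longrightarrow> N *v x = 0"
  obtains x where "bil h x \<noteq> 0 \<or> bil g x \<noteq> 0" "qform A x = 0" "qform N x = 0"
proof -
  \<comment> \<open>The vectors \<open>p\<close> and \<open>q\<close> span a complement of the line,
    on which \<open>N\<close> is a binary quadratic form.\<close>
  obtain s t where st: "s \<noteq> 0 \<or> t \<noteq> 0"
    "s\<^sup>2 * qform N p + 2 * s * t * bil (N *v p) q + t\<^sup>2 * qform N q = 0"
    by (rule binary_quadratic_zero)
  define w where "w = s *s p + t *s q"
  have w: "bil h w = s" "bil g w = t" by (simp_all add: w_def p q)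
  have Nw: "qform N w = 0"
    using st(2) by (simp add: w_def qform_add [OF N] qform_scale vector_scalar_commute mult_ac)
  have perp: "bil (A *v x) y = 0"
    if "bil h x = 0" "bil g x = 0" "bil h y = 0" "bil g y = 0" for x y
    using isotropic [of "x + y"] isotropic [of x] isotropic [of y] that by (simp add: qform_add [OF A])
  have "\<exists>l. bil h l = 0 \<and> bil g l = 0 \<and> bil (A *v w) l \<noteq> 0"
  proof (rule ccontr)
    assume "\<not> ?thesis"
    then have wperp: "bil (A *v w) y = 0" if "bil h y = 0" "bil g y = 0" for y
      using that by blast
    \<comment> \<open>Now \<open>w\<close> and a basis \<open>l\<close>, \<open>m\<close> of the
      line would be three independent vectors orthogonal to the line, but nondegeneracy of
      \<open>A\<close> leaves room for two only.\<close>
    obtain l where l: "l \<noteq> 0" "bil h l = 0" "bil g l = 0"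
      by (rule exists_common_zero [of h g g])
    then obtain i where i: "l $ i \<noteq> 0" by (auto simp: vec_eq_iff)
    obtain m where m: "m \<noteq> 0" "bil h m = 0" "bil g m = 0" "bil (axis i 1) m = 0"
      by (rule exists_common_zero)
    \<comment> \<open>Turns orthogonality of \<open>z\<close> to \<open>r\<close> into a linear
      condition on the coefficients \<open>c\<close> of \<open>z\<close> in \<open>w\<close>,
      \<open>l\<close>, \<open>m\<close>, padded by a zero in the fourth place.\<close>
    define Q :: "complex ^ 4 \<Rightarrow> complex ^ 4" where "Q r = (\<chi> j. if j = 1 then bil (A *v w) r else if j = 2 then bil (A *v l) r
      else if j = 3 then bil (A *v m) r else 0)" for r
    obtain c where c: "c \<noteq> 0" "bil (Q p) c = 0" "bil (Q q) c = 0" "bil (axis 4 1) c = 0"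
      by (rule exists_common_zero)
    have c4: "c $ 4 = 0" using c(4) by (simp add: bil_axis_left)
    define z where "z = c $ 1 *s w + c $ 2 *s l + c $ 3 *s m"
    have Q: "bil (A *v z) r = bil (Q r) c" for r
      by (simp add: z_def matrix_vector_right_distrib vector_scalar_commute)
         (simp add: Q_def bil_def sum_4 mult.commute)
    have "bil (A *v z) y = 0" for y
    proof -
      have "bil h (y - (bil h y *s p + bil g y *s q)) = 0" "bil g (y - (bil h y *s p + bil g y *s q)) = 0"
        by (simp_all add: p q)
      then have "bil (A *v z) (y - (bil h y *s p + bil g y *s q)) = 0"
        using wperp perp l m
        by (simp add: z_def matrix_vector_right_distrib vector_scalar_commute del: bil_diff(2))
      then show ?thesis using Q c by simp
    qed
    then have "(A *v z) $ i = 0" for i using bil_axis [of "A *v z" i] by simp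
    then have "A *v z = 0" by (simp add: vec_eq_iff)
    then have z: "z = 0" by (rule ker)
    have "bil h z = c $ 1 * s" "bil g z = c $ 1 * t" by (simp_all add: z_def w l m)
    then have c1: "c $ 1 = 0" using z st(1) by auto
    have "z $ i = c $ 2 * l $ i" using m(4) by (simp add: z_def c1 bil_axis_left)
    then have c2: "c $ 2 = 0" using z i by simp
    have "c $ 3 *s m = 0" using z by (simp add: z_def c1 c2)
    then have "c $ 3 = 0" using m(1) by simp
    then show False using c(1) c1 c2 c4 by (simp add: vec_eq_iff forall_4)
  qed
  then obtain l where l: "bil h l = 0" "bil g l = 0" "bil (A *v w) l \<noteq> 0" by blast
  \<comment> \<open>Moving from \<open>w\<close> along \<open>l\<close> changes
    \<open>qform A\<close> by an affine function of the parameter, as \<open>l\<close> is isotropic,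
    and fixes \<open>qform N\<close>, as \<open>N\<close> kills \<open>l\<close>.\<close>
  define r where "r = - qform A w / (2 * bil (A *v w) l)"
  have r: "qform A w + 2 * (r * bil (A *v w) l) = 0" using l(3) by (simp add: r_def)
  show thesis
  proof (rule that [of "w + r *s l"])
    show "bil h (w + r *s l) \<noteq> 0 \<or> bil g (w + r *s l) \<noteq> 0" using st(1) by (simp add: w l)
    show "qform A (w + r *s l) = 0"
      using r isotropic [OF l(1,2)] by (simp add: qform_add [OF A] qform_scale)
    have "N *v l = 0" by (rule kernel [OF l(1,2)])
    moreover from this have "bil (N *v w) l = 0" by (simp flip: bil_symmetric [OF N])
    ultimately show "qform N (w + r *s l) = 0"
      using Nw by (simp add: qform_add [OF N] qform_scale qform_def [of N l])
  qed
qed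

text \<open>
  Four points of a conic with \<open>(f + k) + (f - k) = (f + z) + (f - z)\<close> can only be eigenvectors for
  the same eigenvalue, so the eigenvectors on the conic fill the plane. The vectors \<open>f\<close>, \<open>k\<close>, \<open>z\<close>
  are \<open>S\<close>-orthogonal with \<open>qform S\<close> equal to \<open>1, -1, -1\<close>; a vector \<open>z\<close> in the radical of \<open>S\<close> is itself a
  point of the conic.
\<close>

lemma eigen_plane:
  assumes A: "transpose A = A" and B: "transpose B = B" and S: "transpose S = S"
    and ker: "\<And>x. A *v x = 0 \<Longrightarrow> x = 0"
    and x0: "bil h x0 = 0" "qform S x0 \<noteq> 0" and "h \<noteq> 0"
    and C: "plane h \<inter> locus S = locus A \<inter> locus B"
    and tangent: "\<And>x. x \<in> plane h \<inter> locus S \<Longrightarrow> \<exists>l. eigen A B l x"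
  obtains l where "\<And>x. bil h x = 0 \<Longrightarrow> eigen A B l x"
proof -
  define f where "f = (1 / csqrt (qform S x0)) *s x0"
  define g where "g = S *v f"
  have f: "bil h f = 0" "qform S f = 1" "bil g f = 1"
  proof -
    show "bil h f = 0" by (simp add: f_def x0)
    show 1: "qform S f = 1" using x0 by (simp add: f_def qform_scale power_divide)
    show "bil g f = 1" using 1 by (simp add: g_def qform_def bil_commute)
  qed
  have split: "qform S (a *s f + y) = a\<^sup>2 + qform S y" if "bil g y = 0" for a y
    using f that by (simp add: qform_add [OF S] qform_scale vector_scalar_commute flip: g_def)
  have point: "\<exists>l. eigen A B l x" if "x \<noteq> 0" "bil h x = 0" "qform S x = 0" for x
    using that tangent [of x] by (simp add: plane_def locus_def)
  show thesis
  proof (cases "\<forall>y. bil h y = 0 \<longrightarrow> bil g y = 0 \<longrightarrow> qform S y = 0")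
    \<comment> \<open>In the plane \<open>S\<close> is the square of the linear form
      \<open>g\<close>, so the conic is a double line.\<close>
    case True
    obtain v where v: "v \<noteq> 0" "bil h v = 0" "bil g v = 0"
      by (rule exists_common_zero [of h g g])
    obtain l where l: "eigen A B l v" using point v True by blast
    have line: "eigen A B l y" if y: "bil h y = 0" "bil g y = 0" for y
    proof (cases "\<exists>c. y = c *s v")
      case True
      then show ?thesis using l eigen_scale by blast
    next
      case False
      have indep: "s = 0 \<and> t = 0" if "s *s v + t *s y = 0" for s t
      proof -
        have "t = 0"
        proof (rule ccontr)
          assume t: "t \<noteq> 0"
          have "t *s y = (- s) *s v" using that by (simp add: add_eq_0_iff)
          then have "(1 / t) *s (t *s y) = (1 / t) *s ((- s) *s v)" by simp
          then have "y = (- s / t) *s v" using t by (simp add: vector_smult_assoc)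
          then show False using False by blast
        qed
        then show ?thesis using that v by simp
      qed
      have "y \<noteq> 0" using False [unfolded not_ex, THEN spec, of 0] by simp
      then obtain m where m: "eigen A B m y" using point y True by blast
      have "v + y \<noteq> 0" using indep [of 1 1] by auto
      then obtain n where n: "eigen A B n (v + y)" using point [of "v + y"] y v True by auto
      show ?thesis using eigen_add_same [OF ker l m n indep] m by simp
    qed
    have onC: "x \<in> plane h \<inter> locus S \<longleftrightarrow> x \<noteq> 0 \<and> bil h x = 0 \<and> bil g x = 0" for x
    proof -
      have "qform S x = (bil g x)\<^sup>2" if "bil h x = 0"
      proof -
        have "bil g (x - bil g x *s f) = 0" "bil h (x - bil g x *s f) = 0"
          using that by (simp_all add: f)
        then show ?thesis using split [of "x - bil g x *s f" "bil g x"] True by simp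
      qed
      then show ?thesis by (auto simp: plane_def locus_def)
    qed
    have "h \<noteq> c *s g" for c
    proof
      assume "h = c *s g"
      then have "c = 0" using f by simp
      then show False using \<open>h = c *s g\<close> \<open>h \<noteq> 0\<close> by simp
    qed
    then obtain p where p: "bil h p = 1" "bil g p = 0" by (rule exists_separating)
    \<comment> \<open>\<open>N\<close> kills the line, and its common zeros with \<open>A\<close>
      are those of \<open>B\<close> with \<open>A\<close>. A common zero off the line is thus a
      point of the intersection outside the conic.\<close>
    define N where "N = B - mscale l A"
    have N: "transpose N = N"
      using A B by (simp add: N_def mscale_def transpose_def vec_eq_iff)
    have Nx: "N *v x = B *v x - l *s (A *v x)" for x
      unfolding N_def matrix_vector_mult_diff_rdistrib by simp
    obtain x where x: "bil h x \<noteq> 0 \<or> bil g x \<noteq> 0" "qform A x = 0" "qform N x = 0"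
    proof (rule common_zero_off_line [OF A N ker p f(1,3)])
      show "qform A x = 0" if "bil h x = 0" "bil g x = 0" for x
        using onC [of x] that C by (cases "x = 0") (auto simp: locus_def qform_def)
      show "N *v x = 0" if "bil h x = 0" "bil g x = 0" for x
        using line [OF that] by (simp add: Nx eigen_def)
    qed
    have "x \<noteq> 0" using x(1) by auto
    moreover have "qform B x = 0" using x(2,3) by (simp add: qform_def Nx)
    ultimately have "x \<in> plane h \<inter> locus S" unfolding C using x(2) by (simp add: locus_def)
    then show thesis using onC [of x] x(1) by blast
  next
    case False
    then obtain k0 where k0: "bil h k0 = 0" "bil g k0 = 0" "qform S k0 \<noteq> 0" by blast
    \<comment> \<open>The imaginary unit makes the value of \<open>S\<close> at \<open>k\<close>
      equal to -1, which puts \<open>f + k\<close> and \<open>f - k\<close> on the conic.\<close>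
    define k where "k = (\<i> / csqrt (qform S k0)) *s k0"
    have k: "bil h k = 0" "bil g k = 0" "qform S k = - 1"
      using k0 by (simp_all add: k_def qform_scale power_divide)
    define e where "e = S *v k"
    have e: "bil e k = - 1" "bil e f = 0"
      using k bil_symmetric [OF S, of k f]
      by (simp_all add: e_def qform_def bil_commute [of "S *v k"] g_def) (simp add: bil_commute)
    have pt: "\<exists>l. eigen A B l (f + y)" if "bil h y = 0" "bil g y = 0" "qform S y = - 1" for y
    proof (rule point)
      show "bil h (f + y) = 0" using f that by simp
      show "qform S (f + y) = 0" using split [of y 1] that by simp
      have "bil g (f + y) \<noteq> 0" using f that by simp
      then show "f + y \<noteq> 0" by (auto simp del: bil_add)
    qed
    obtain l where l: "eigen A B l (f + k)" using pt k by blast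
    obtain m where "eigen A B m (f + - k)" using pt [of "- k"] k by auto
    then have m: "eigen A B m (f - k)" by simp
    have main: "eigen A B l y \<and> l = m"
      if y: "y \<noteq> 0" "bil h y = 0" "bil g y = 0" "bil e y = 0" for y
    proof (cases "qform S y = 0")
      case True
      then obtain n where n: "eigen A B n y" using point y by blast
      have qS: "qform S (k + y) = - 1" "qform S (- k + y) = - 1"
        using k y True by (simp_all add: qform_add [OF S] matrix_vector_mult_uminus flip: e_def
            del: uminus_add_conv_diff add_uminus_conv_diff)
      obtain r where r: "eigen A B r (f + k + y)"
        using pt [of "k + y"] k y qS by (auto simp: add.assoc)
      obtain r' where r': "eigen A B r' (f + (- k + y))"
        using pt [of "- k + y"] k y qS(2) by (auto simp del: uminus_add_conv_diff add_uminus_conv_diff)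
      have "l = n"
      proof (rule eigen_add_same [OF ker l n r])
        fix s t assume 0: "s *s (f + k) + t *s y = 0"
        have "bil g (s *s (f + k) + t *s y) = s" using f k y by simp
        then have "s = 0" unfolding 0 by simp
        then show "s = 0 \<and> t = 0" using 0 y by simp
      qed
      moreover have "m = n"
      proof (rule eigen_add_same [OF ker m n])
        show "eigen A B r' (f - k + y)" using r' by (simp add: algebra_simps)
        fix s t assume 0: "s *s (f - k) + t *s y = 0"
        have "bil g (s *s (f - k) + t *s y) = s" using f k y by simp
        then have "s = 0" unfolding 0 by simp
        then show "s = 0 \<and> t = 0" using 0 y by simp
      qed
      ultimately show ?thesis using n by simp
    next
      case False
      define z where "z = (\<i> / csqrt (qform S y)) *s y"
      have z: "bil h z = 0" "bil g z = 0" "qform S z = - 1" "bil e z = 0"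
        using y False by (simp_all add: z_def qform_scale power_divide)
      obtain n where n: "eigen A B n (f + z)" using pt z by blast
      obtain r where "eigen A B r (f + - z)" using pt [of "- z"] z by auto
      then have r: "eigen A B r (f - z)" by simp
      have "A *v ((l + m - n - r) *s f + (l - m) *s k + (r - n) *s z) =
        (l *s (A *v (f + k)) + m *s (A *v (f - k))) - (n *s (A *v (f + z)) + r *s (A *v (f - z)))"
        by (simp add: matrix_vector_right_distrib matrix_vector_mult_diff_distrib
            vector_scalar_commute algebra_simps)
      also have "\<dots> = (B *v (f + k) + B *v (f - k)) - (B *v (f + z) + B *v (f - z))"
        using l m n r by (simp only: eigen_def)
      also have "\<dots> = 0"
        by (simp add: matrix_vector_right_distrib matrix_vector_mult_diff_distrib)
      finally have 0: "(l + m - n - r) *s f + (l - m) *s k + (r - n) *s z = 0" by (rule ker)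
      \<comment> \<open>The forms \<open>e\<close> and \<open>g\<close> vanish on \<open>z\<close>
        and isolate the coefficients of \<open>k\<close>, up to sign, and of
        \<open>f\<close>.\<close>
      have "bil e ((l + m - n - r) *s f + (l - m) *s k + (r - n) *s z) = m - l"
        by (simp add: e z)
      then have lm: "l = m" unfolding 0 by simp
      have "bil g ((l + m - n - r) *s f + (l - m) *s k + (r - n) *s z) = l + m - n - r"
        by (simp add: f k z)
      then have sum0: "l + m - n - r = 0" unfolding 0 by simp
      have "l - m = 0" using lm by simp
      then have "(r - n) *s z = 0" using 0 unfolding sum0 by (simp del: vector_sub_rdistrib)
      moreover have "z \<noteq> 0" using z(3) by (auto simp: qform_def)
      ultimately have "r - n = 0" unfolding vector_mul_eq_0 by simp
      then have nr: "n = l" "r = l" using lm sum0 by auto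
      have "eigen A B l ((f + z) + (- 1) *s (f - z))"
        using eigen_add [OF _ eigen_scale] n r unfolding nr by blast
      then have "eigen A B l ((csqrt (qform S y) / (2 * \<i>)) *s ((f + z) + (- 1) *s (f - z)))"
        by (rule eigen_scale)
      also have "(csqrt (qform S y) / (2 * \<i>)) *s ((f + z) + (- 1) *s (f - z)) = y"
        using False by (simp add: z_def vec_eq_iff field_simps)
      finally show ?thesis using lm by simp
    qed
    obtain y0 where "y0 \<noteq> 0" "bil h y0 = 0" "bil g y0 = 0" "bil e y0 = 0"
      by (rule exists_common_zero)
    then have lm: "l = m" using main by blast
    have perp: "eigen A B l y" if "bil h y = 0" "bil g y = 0" "bil e y = 0" for y
      using main [of y] that by (cases "y = 0") (auto simp: eigen_def)
    have "eigen A B l x" if hx: "bil h x = 0" for x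
    proof -
      \<comment> \<open>Coordinates of \<open>x\<close> along \<open>f\<close> and \<open>k\<close>,
        the sign of \<open>b\<close> coming from \<open>bil e k = - 1\<close>; \<open>perp\<close>
        handles the remainder.\<close>
      define a where "a = bil g x"
      define b where "b = - bil e x"
      have "eigen A B l (x - (a *s f + b *s k))"
        by (rule perp) (simp_all add: hx f k e a_def b_def)
      then have "eigen A B l ((((a + b) / 2) *s (f + k) + ((a - b) / 2) *s (f - k)) + (x - (a *s f + b *s k)))"
        using l m unfolding lm by (intro eigen_add [OF eigen_add [OF eigen_scale eigen_scale]])
      also have "(((a + b) / 2) *s (f + k) + ((a - b) / 2) *s (f - k)) + (x - (a *s f + b *s k)) = x"
        by (simp add: vec_eq_iff field_simps)
      finally show ?thesis .
    qed
    then show thesis by (rule that)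
  qed
qed

text \<open>On the plane of the conic \<open>B\<close> agrees with \<open>l\<close> times
  \<open>A\<close>, so the rows of the difference are multiples of \<open>h\<close>. By symmetry it
  is a multiple of \<open>outer h\<close>, and a complex square root absorbs the factor.\<close>

lemma basket_decomposition:
  assumes "smooth_quadric A" "smooth_quadric B" "basket A B"
  obtains c h where "c \<noteq> 0" "h \<noteq> 0" "B = mscale c A + outer h"
proof -
  have A: "transpose A = A" and B: "transpose B = B"
    using assms by (auto intro: smooth_quadric_symmetric)
  obtain C where C: "is_conic C" "locus A \<inter> locus B = C"
    "\<And>x. x \<in> C \<Longrightarrow> tangent_space A x = tangent_space B x" and ne: "quadric_pt A \<noteq> quadric_pt B"
    using assms(3) unfolding basket_def by blast
  then obtain h S where h: "h \<noteq> 0" "is_quadric S" "\<not> plane h \<subseteq> locus S" "C = plane h \<inter> locus S"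
    unfolding is_conic_def by blast
  then obtain x0 where x0: "bil h x0 = 0" "qform S x0 \<noteq> 0"
    unfolding plane_def locus_def by blast
  obtain l where l: "eigen A B l x" if "bil h x = 0" for x
  proof (rule eigen_plane [OF A B _ _ x0 h(1)])
    show "transpose S = S" using h(2) by (simp add: is_quadric_def)
    show "x = 0" if "A *v x = 0" for x using assms(1) that by (rule smooth_quadric_ker)
    show "plane h \<inter> locus S = locus A \<inter> locus B" using C(2) h(4) by simp
    show "\<exists>l. eigen A B l x" if "x \<in> plane h \<inter> locus S" for x
      using C(3) [of x] that h(4) tangent_eigen by blast
  qed blast
  define N where "N = B - mscale l A"
  have N: "N $ i $ j = N $ j $ i" for i j
  proof -
    have "transpose N = N" using A B by (simp add: N_def mscale_def transpose_def vec_eq_iff)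
    from arg_cong [OF this, of "\<lambda>M. M $ j $ i"] show ?thesis by (simp add: transpose_def)
  qed
  have "\<exists>c. N $ i = c *s h" for i
  proof (rule parallel_if_ker_subset [of h "N $ i"])
    fix x assume "bil h x = 0"
    then have "(N *v x) $ i = 0"
      using l [of x] by (simp add: N_def matrix_vector_mult_diff_rdistrib eigen_def)
    then show "bil (N $ i) x = 0" by (simp add: bil_def matrix_vector_mult_def)
  qed blast
  then obtain c where c: "\<And>i. N $ i = c i *s h" by metis
  obtain k where k: "h $ k \<noteq> 0" using h(1) by (auto simp: vec_eq_iff)
  define d where "d = c k / h $ k"
  have "c i = d * h $ i" for i
    using N [of i k] k by (simp add: c d_def field_simps)
  then have "N = outer (csqrt d *s h)"
    by (simp add: vec_eq_iff c outer_def) (simp flip: power2_eq_square mult.assoc add: mult.commute mult.left_commute)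
  then have dec: "B = mscale l A + outer (csqrt d *s h)" by (simp add: N_def algebra_simps)
  have B_ker: "B *v x = 0 \<Longrightarrow> x = 0" for x using assms(2) by (rule smooth_quadric_ker)
  have "l \<noteq> 0"
  proof
    assume "l = 0"
    obtain x where "x \<noteq> 0" "bil h x = 0" by (rule exists_common_zero [of h h h])
    then show False using l [of x] B_ker [of x] by (simp add: eigen_def \<open>l = 0\<close>)
  qed
  moreover have "csqrt d *s h \<noteq> 0"
  proof
    assume 0: "csqrt d *s h = 0"
    have B_eq: "B = mscale l A" using dec unfolding 0 by simp
    then have "quadric_pt A = quadric_pt B" using \<open>l \<noteq> 0\<close> by (simp add: quadric_pt_mscale)
    then show False using ne by simp
  qed
  ultimately show thesis using dec by (rule that)
qed

subsection \<open>Distinct ratios\<close>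

text \<open>A vector orthogonal to the three coefficient vectors, the constant one, \<open>u\<close>
  and \<open>v\<close>, yields a nontrivial relation among the \<open>q i\<close>.\<close>

lemma lin_indep_not_in_three_space:
  assumes "lin_indep q" and c: "\<And>i. c i \<noteq> 0"
    and q: "\<And>i. mscale (c i) (q i) = X + mscale (u i) Y + mscale (v i) Z"
  shows False
proof -
  obtain a where a: "a \<noteq> 0" "bil (\<chi> i. 1) a = 0" "bil (\<chi> i. u i) a = 0" "bil (\<chi> i. v i) a = 0"
    by (rule exists_common_zero)
  have "(\<Sum>i\<in>UNIV. mscale (a $ i * c i) (q i)) = 0"
  proof -
    have "mscale (a $ i * c i) (q i) = mscale (a $ i) X + mscale (u i * a $ i) Y + mscale (v i * a $ i) Z" for i
    proof -
      have "mscale (a $ i * c i) (q i) = mscale (a $ i) (mscale (c i) (q i))"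
        by (simp add: mscale_def mult.assoc)
      then show ?thesis unfolding q by (simp add: mscale_def vec_eq_iff algebra_simps)
    qed
    then have "(\<Sum>i\<in>UNIV. mscale (a $ i * c i) (q i)) =
        mscale (\<Sum>i\<in>UNIV. a $ i) X + mscale (\<Sum>i\<in>UNIV. u i * a $ i) Y + mscale (\<Sum>i\<in>UNIV. v i * a $ i) Z"
      by (simp add: sum.distrib) (simp add: mscale_def vec_eq_iff sum_distrib_right)
    also have "\<dots> = 0" using a(2-4) by (simp add: bil_def mscale_def vec_eq_iff)
    finally show ?thesis .
  qed
  then have "\<forall>i. a $ i * c i = 0" using assms(1) [unfolded lin_indep_def, THEN spec, of "\<lambda>i. a $ i * c i"] by blast
  then show False using c a(1) by (simp add: vec_eq_iff)
qed

text \<open>If \<open>p\<close> vanishes at \<open>x\<close>, the difference kills \<open>x\<close>,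
  so \<open>bil h x *s h = bil k x *s k\<close>. Were \<open>bil h x\<close> nonzero,
  \<open>h\<close> would be plus or minus \<open>k\<close> and the difference zero.\<close>

lemma outer_difference_rank_one:
  assumes "outer h - outer k = mscale d (outer p)" "mscale d (outer p) \<noteq> 0"
  obtains f where "h = f *s p"
proof (rule parallel_if_ker_subset [of p h])
  fix x assume x: "bil p x = 0"
  have "(outer h - outer k) *v x = 0" unfolding assms(1) by (simp add: outer_mv x)
  then have hk: "bil h x *s h = bil k x *s k"
    by (simp add: matrix_vector_mult_diff_rdistrib outer_mv)
  show "bil h x = 0"
  proof (rule ccontr)
    assume hx: "bil h x \<noteq> 0"
    have "(1 / bil h x) *s (bil h x *s h) = (1 / bil h x) *s (bil k x *s k)"
      by (simp only: hk)
    then have h: "h = (bil k x / bil h x) *s k" using hx by (simp add: vector_smult_assoc)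
    define e where "e = bil k x / bil h x"
    have "bil h x *s h = (e\<^sup>2 * bil k x) *s k"
      by (subst (1 2) h) (simp add: vector_smult_assoc power2_eq_square mult_ac flip: e_def)
    then have "(e\<^sup>2 * bil k x - bil k x) *s k = 0" using hk by simp
    then have "(e\<^sup>2 - 1) * bil k x = 0 \<or> k = 0" by (simp only: vector_mul_eq_0 left_diff_distrib mult_1)
    moreover have "k \<noteq> 0" "bil k x \<noteq> 0" using hx h by auto
    ultimately have "e\<^sup>2 = 1" by simp
    moreover have "outer h = mscale (e\<^sup>2) (outer k)"
      using h by (simp add: outer_def mscale_def vec_eq_iff power2_eq_square flip: e_def)
    ultimately have "outer h - outer k = 0" by (simp add: mscale_def vec_eq_iff)
    then show False using assms by simp
  qed
qed (use that in blast)

text \<open>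
  If \<open>h\<^sub>0\<close> and \<open>k\<^sub>0\<close> are independent, then \<open>h = s h\<^sub>0 + t k\<^sub>0\<close> with \<open>s\<^sup>2 - t\<^sup>2 = 1\<close>; this relation cuts
  down the four monomials \<open>1, s\<^sup>2, s t, t\<^sup>2\<close> to a space of dimension three.
\<close>

lemma outer_difference_three_space:
  assumes "outer h\<^sub>0 - outer k\<^sub>0 \<noteq> 0"
  obtains X Y Z where
    "\<And>h k. outer h - outer k = outer h\<^sub>0 - outer k\<^sub>0 \<Longrightarrow> \<exists>u v. outer h = X + mscale u Y + mscale v Z"
proof -
  note three_space = that
  have rank_one: thesis if p: "outer h\<^sub>0 - outer k\<^sub>0 = mscale d (outer p)" for d p
  proof (rule three_space)
    fix h k assume hk: "outer h - outer k = outer h\<^sub>0 - outer k\<^sub>0"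
    then obtain f where f: "h = f *s p"
      using outer_difference_rank_one [of h k d p] p assms by auto
    then have "outer h = 0 + mscale (f\<^sup>2) (outer p) + mscale 0 0"
      by (simp add: outer_def mscale_def vec_eq_iff power2_eq_square)
    then show "\<exists>u v. outer h = 0 + mscale u (outer p) + mscale v 0" by blast
  qed
  consider c where "h\<^sub>0 = c *s k\<^sub>0" | c where "k\<^sub>0 = c *s h\<^sub>0"
    | "\<And>c. h\<^sub>0 \<noteq> c *s k\<^sub>0" "\<And>c. k\<^sub>0 \<noteq> c *s h\<^sub>0" by blast
  then show thesis
  proof cases
    case (1 c)
    show thesis
      by (rule rank_one [of "c\<^sup>2 - 1" "k\<^sub>0"])
         (simp add: 1 outer_def mscale_def vec_eq_iff power2_eq_square algebra_simps)
  next
    case (2 c)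
    show thesis
      by (rule rank_one [of "1 - c\<^sup>2" "h\<^sub>0"])
         (simp add: 2 outer_def mscale_def vec_eq_iff power2_eq_square algebra_simps)
  next
    case 3
    \<comment> \<open>Applying the difference to the dual vectors \<open>x\<close> and
      \<open>y\<close> expresses \<open>h\<^sub>0\<close> and \<open>k\<^sub>0\<close> through
      \<open>h\<close> and \<open>k\<close>; pairing the results with \<open>x\<close> and
      \<open>y\<close> again gives \<open>rel\<close>.\<close>
    obtain x where x: "bil h\<^sub>0 x = 1" "bil k\<^sub>0 x = 0" using exists_separating [OF 3(1)] by blast
    obtain y where y: "bil k\<^sub>0 y = 1" "bil h\<^sub>0 y = 0" using exists_separating [OF 3(2)] by blast
    show thesis
    proof (rule three_space)
      fix h k assume hk: "outer h - outer k = outer h\<^sub>0 - outer k\<^sub>0"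
      define s s' t t' where "s = bil h x" and "s' = bil k x" and "t = bil h y" and "t' = bil k y"
      have "(outer h - outer k) *v x = (outer h\<^sub>0 - outer k\<^sub>0) *v x" by (simp only: hk)
      then have h0: "h\<^sub>0 = s *s h - s' *s k"
        by (simp add: matrix_vector_mult_diff_rdistrib outer_mv x s_def s'_def)
      have "(outer h - outer k) *v y = (outer h\<^sub>0 - outer k\<^sub>0) *v y" by (simp only: hk)
      then have "- k\<^sub>0 = t *s h - t' *s k"
        by (simp add: matrix_vector_mult_diff_rdistrib outer_mv y t_def t'_def)
      then have k0: "k\<^sub>0 = t' *s k - t *s h" by (simp add: minus_equation_iff [of k\<^sub>0])
      have "s * s - s' * s' = 1" "s * t - s' * t' = 0" "t' * t' - t * t = 1"
        using x(1) y unfolding h0 k0 by (simp_all add: s_def s'_def t_def t'_def)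
      then have rel: "s'\<^sup>2 = s\<^sup>2 - 1" "t'\<^sup>2 = t\<^sup>2 + 1" "s' * t' = s * t"
        by (simp_all add: power2_eq_square algebra_simps)
      have "s\<^sup>2 * t\<^sup>2 = (s\<^sup>2 - 1) * (t\<^sup>2 + 1)"
        unfolding rel(1,2) [symmetric] power_mult_distrib [symmetric] rel(3) ..
      then have st: "s\<^sup>2 = t\<^sup>2 + 1" by (simp add: algebra_simps)
      have "(s * s' - t * t')\<^sup>2 = s\<^sup>2 * s'\<^sup>2 + t\<^sup>2 * t'\<^sup>2 - 2 * s * t * (s' * t')"
        by (simp add: power2_eq_square algebra_simps)
      also have "\<dots> = s\<^sup>2 * (s\<^sup>2 - 1) + t\<^sup>2 * (t\<^sup>2 + 1) - 2 * (s\<^sup>2 * t\<^sup>2)"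
        unfolding rel by (simp add: power2_eq_square algebra_simps)
      also have "\<dots> = 0" unfolding st by (simp add: algebra_simps)
      finally have 0: "s * s' = t * t'" by simp
      have "s *s h\<^sub>0 + t *s k\<^sub>0 = (s\<^sup>2 - t\<^sup>2) *s h - (s * s' - t * t') *s k"
        unfolding h0 k0 by (simp add: vec_eq_iff power2_eq_square algebra_simps)
      then have h: "h = s *s h\<^sub>0 + t *s k\<^sub>0" unfolding 0 st by (simp add: algebra_simps)
      have "outer h = mscale (s\<^sup>2) (outer h\<^sub>0) + mscale (s * t) (outer (h\<^sub>0 + k\<^sub>0) - outer h\<^sub>0 - outer k\<^sub>0)
        + mscale (t\<^sup>2) (outer k\<^sub>0)"
        unfolding h by (simp add: outer_def mscale_def vec_eq_iff power2_eq_square algebra_simps)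
      \<comment> \<open>Eliminating \<open>s\<^sup>2\<close> leaves one fixed matrix and two free
        coefficients.\<close>
      then have "outer h = outer h\<^sub>0 + mscale (s * t) (outer (h\<^sub>0 + k\<^sub>0) - outer h\<^sub>0 - outer k\<^sub>0)
        + mscale (t\<^sup>2) (outer h\<^sub>0 + outer k\<^sub>0)"
        unfolding st by (simp add: mscale_def vec_eq_iff algebra_simps)
      then show "\<exists>u v. outer h = outer h\<^sub>0 + mscale u (outer (h\<^sub>0 + k\<^sub>0) - outer h\<^sub>0 - outer k\<^sub>0)
        + mscale v (outer h\<^sub>0 + outer k\<^sub>0)" by blast
    qed
  qed
qed

text \<open>The matrix \<open>b\<^sub>1 - mscale r b\<^sub>2\<close> is
  \<open>outer (h i) - outer (csqrt r *s k i)\<close> for every \<open>i\<close>. If it were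
  nonzero, \<open>outer_difference_three_space\<close> would put all \<open>q i\<close> into the
  span of three matrices.\<close>

lemma proportional_scalars_imp_proportional:
  assumes "lin_indep q" "\<And>i. d i \<noteq> 0"
    and b1: "\<And>i. b\<^sub>1 = mscale (r * d i) (q i) + outer (h i)"
    and b2: "\<And>i. b\<^sub>2 = mscale (d i) (q i) + outer (k i)"
    and "r \<noteq> 0"
  shows "b\<^sub>1 = mscale r b\<^sub>2"
proof (rule ccontr)
  assume ne: "b\<^sub>1 \<noteq> mscale r b\<^sub>2"
  have D: "b\<^sub>1 - mscale r b\<^sub>2 = outer (h i) - outer (csqrt r *s k i)" for i
  proof -
    have "outer (csqrt r *s k i) = mscale (csqrt r * csqrt r) (outer (k i))"
      by (simp add: outer_def mscale_def vec_eq_iff mult_ac)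
    also have "csqrt r * csqrt r = r" by (simp flip: power2_eq_square)
    finally have k: "outer (csqrt r *s k i) = mscale r (outer (k i))" .
    show ?thesis
      unfolding k by (subst b1 [of i], subst b2 [of i]) (simp add: mscale_def vec_eq_iff algebra_simps)
  qed
  have "outer (h 1) - outer (csqrt r *s k 1) \<noteq> 0" using ne D [of 1] by auto
  then obtain X Y Z where XYZ:
    "\<And>h' k'. outer h' - outer k' = outer (h 1) - outer (csqrt r *s k 1) \<Longrightarrow> \<exists>u v. outer h' = X + mscale u Y + mscale v Z"
    using outer_difference_three_space by blast
  have "\<forall>i. \<exists>u v. outer (h i) = X + mscale u Y + mscale v Z"
    using XYZ D by metis
  then obtain u v where uv: "\<And>i. outer (h i) = X + mscale (u i) Y + mscale (v i) Z" by metis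
  show False
  proof (rule lin_indep_not_in_three_space [OF assms(1)])
    show "r * d i \<noteq> 0" for i using assms by simp
    show "mscale (r * d i) (q i) = (b\<^sub>1 - X) + mscale (u i) (- Y) + mscale (v i) (- Z)" for i
      using uv [of i] by (subst b1 [of i]) (simp add: mscale_def vec_eq_iff)
  qed
qed

subsection \<open>Orthogonality\<close>

text \<open>\<open>A\<close> factors as \<open>M ** N\<close>, with the \<open>w m\<close> as
  columns of \<open>M\<close> and their multiples by \<open>r m\<close> as rows of \<open>N\<close>.
  Since one-sided inverses are two-sided, \<open>N ** (G ** M)\<close> is the identity, and its
  entries are the pairings.\<close>

lemma rank_one_frame_orthogonal:
  fixes w :: "4 \<Rightarrow> complex ^ 4"
  assumes "A ** G = mat 1" and A: "A = (\<chi> i j. \<Sum>m\<in>UNIV. r m * w m $ i * w m $ j)"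
  shows "r m * bil (w m) (G *v w n) = (if m = n then 1 else 0)"
proof -
  define M :: "complex ^ 4 ^ 4" where "M = (\<chi> i m. w m $ i)"
  define N :: "complex ^ 4 ^ 4" where "N = (\<chi> m j. r m * w m $ j)"
  have "A = M ** N"
    unfolding A by (simp add: M_def N_def matrix_matrix_mult_def mult_ac)
  then have "M ** (N ** G) = mat 1" using assms(1) by (simp add: matrix_mul_assoc)
  then have "(N ** G) ** M = mat 1" by (rule iffD1 [OF matrix_left_right_inverse])
  then have "N ** (G ** M) = mat 1" by (simp only: matrix_mul_assoc)
  then have "(N ** (G ** M)) $ m $ n = (if m = n then 1 else 0)" by (simp add: mat_def)
  moreover have "(N ** (G ** M)) $ m $ n = r m * bil (w m) (G *v w n)"
    by (simp add: matrix_matrix_mult_def matrix_vector_mult_def bil_def M_def N_def sum_distrib_left mult_ac)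
  ultimately show ?thesis by simp
qed

text \<open>
  Eliminating \<open>B\<close> writes \<open>D A\<close> as a combination of the four squares of \<open>h\<^sub>1, h\<^sub>2, k\<^sub>1, k\<^sub>2\<close>.
\<close>

lemma basket_pair_orthogonal:
  assumes "A ** G = mat 1"
    and "mscale c\<^sub>1 A + outer h\<^sub>1 = mscale d\<^sub>1 B + outer k\<^sub>1"
    and "mscale c\<^sub>2 A + outer h\<^sub>2 = mscale d\<^sub>2 B + outer k\<^sub>2"
    and d: "d\<^sub>1 \<noteq> 0" "d\<^sub>2 \<noteq> 0" and D: "D = d\<^sub>2 * c\<^sub>1 - d\<^sub>1 * c\<^sub>2" "D \<noteq> 0"
  shows "bil h\<^sub>1 (G *v h\<^sub>2) = 0" "bil h\<^sub>2 (G *v h\<^sub>1) = 0"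
    "bil h\<^sub>1 (G *v h\<^sub>1) = - D / d\<^sub>2" "bil h\<^sub>2 (G *v h\<^sub>2) = D / d\<^sub>1"
proof -
  define w :: "4 \<Rightarrow> complex ^ 4" where
    "w m = (if m = 1 then h\<^sub>1 else if m = 2 then h\<^sub>2 else if m = 3 then k\<^sub>1 else k\<^sub>2)" for m
  \<comment> \<open>Coefficients obtained by subtracting \<open>d\<^sub>1\<close> times the second
    equation from \<open>d\<^sub>2\<close> times the first and dividing by \<open>D\<close>.\<close>
  define r :: "4 \<Rightarrow> complex" where
    "r m = (if m = 1 then - d\<^sub>2 / D else if m = 2 then d\<^sub>1 / D else if m = 3 then d\<^sub>2 / D else - d\<^sub>1 / D)" for m
  have "A = (\<chi> i j. \<Sum>m\<in>UNIV. r m * w m $ i * w m $ j)"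
  proof (simp add: vec_eq_iff sum_4, intro allI)
    fix i j
    have "c\<^sub>1 * A $ i $ j + h\<^sub>1 $ i * h\<^sub>1 $ j = d\<^sub>1 * B $ i $ j + k\<^sub>1 $ i * k\<^sub>1 $ j"
      using arg_cong [OF assms(2), of "\<lambda>M. M $ i $ j"] by (simp add: mscale_def outer_def)
    moreover have "c\<^sub>2 * A $ i $ j + h\<^sub>2 $ i * h\<^sub>2 $ j = d\<^sub>2 * B $ i $ j + k\<^sub>2 $ i * k\<^sub>2 $ j"
      using arg_cong [OF assms(3), of "\<lambda>M. M $ i $ j"] by (simp add: mscale_def outer_def)
    ultimately have "D * A $ i $ j = - d\<^sub>2 * h\<^sub>1 $ i * h\<^sub>1 $ j + d\<^sub>1 * h\<^sub>2 $ i * h\<^sub>2 $ j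
      + d\<^sub>2 * k\<^sub>1 $ i * k\<^sub>1 $ j - d\<^sub>1 * k\<^sub>2 $ i * k\<^sub>2 $ j"
      unfolding D(1) by algebra
    then have "A $ i $ j = (- d\<^sub>2 * h\<^sub>1 $ i * h\<^sub>1 $ j + d\<^sub>1 * h\<^sub>2 $ i * h\<^sub>2 $ j
      + d\<^sub>2 * k\<^sub>1 $ i * k\<^sub>1 $ j - d\<^sub>1 * k\<^sub>2 $ i * k\<^sub>2 $ j) / D"
      using D(2) by (simp add: nonzero_eq_divide_eq mult.commute)
    then show "A $ i $ j = r 1 * w 1 $ i * w 1 $ j + r 2 * w 2 $ i * w 2 $ j + r 3 * w 3 $ i * w 3 $ j
      + r 4 * w 4 $ i * w 4 $ j"
      by (simp add: r_def w_def add_divide_distrib diff_divide_distrib)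
  qed
  from rank_one_frame_orthogonal [OF assms(1) this]
  have *: "r m * bil (w m) (G *v w n) = (if m = n then 1 else 0)" for m n .
  have "r 1 \<noteq> 0" "r 2 \<noteq> 0" using d D(2) by (simp_all add: r_def)
  then have "bil h\<^sub>1 (G *v h\<^sub>1) = 1 / r 1" "bil h\<^sub>2 (G *v h\<^sub>2) = 1 / r 2"
    using * [of 1 1] * [of 2 2] by (simp_all add: w_def nonzero_eq_divide_eq mult.commute)
  then show "bil h\<^sub>1 (G *v h\<^sub>1) = - D / d\<^sub>2" "bil h\<^sub>2 (G *v h\<^sub>2) = D / d\<^sub>1"
    by (simp_all add: r_def)
  show "bil h\<^sub>1 (G *v h\<^sub>2) = 0" "bil h\<^sub>2 (G *v h\<^sub>1) = 0"
    using * [of 1 2] * [of 2 1] d D(2) by (simp_all add: r_def w_def)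
qed

lemma other_index:
  obtains k :: 4 where "k \<noteq> a" "k \<noteq> b" "k \<noteq> c"
proof -
  have "card {a, b, c} \<le> 3" by (simp add: card_insert_if)
  then have "{a, b, c} \<noteq> UNIV" by auto
  then show thesis using that by blast
qed

text \<open>For distinct indices the square of \<open>x a\<close> is
  \<open>(x a * x b) * (x a * x c) / (x b * x c)\<close>, hence 1.\<close>

lemma all_minus_one_if_pairwise_inverse:
  fixes x :: "4 \<Rightarrow> complex"
  assumes x: "\<And>a b. a \<noteq> b \<Longrightarrow> x a * x b = 1" and ne: "\<And>a. x a \<noteq> 1"
  shows "x a = - 1"
proof -
  obtain b where b: "b \<noteq> a" by (rule other_index)
  obtain c where "c \<noteq> a" "c \<noteq> b" by (rule other_index)
  with b have "x a * x b = 1" "x a * x c = 1" "x b * x c = 1" using x by auto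
  then have "(x a)\<^sup>2 = 1" by algebra
  then show ?thesis using ne [of a] by (simp add: power2_eq_1_iff)
qed

lemma baskets_orthogonal:
  fixes q b :: "4 \<Rightarrow> complex ^ 4 ^ 4"
  assumes G: "q k ** G = mat 1"
    and b: "\<And>i m. b m = mscale (c i m) (q i) + outer (h i m)"
    and c: "\<And>i m. c i m \<noteq> 0"
    and nonprop: "\<And>m n. m \<noteq> n \<Longrightarrow> \<exists>i. c i m * c k n \<noteq> c i n * c k m"
  shows "bil (h k m) (G *v h k n) = (if m = n then - 2 * c k m else 0)"
    and "c i m * c k n = c i n * c k m \<or> c i m * c k n = - (c i n * c k m)"
proof -
  \<comment> \<open>By the determinant formula for rank one updates, this is
    \<open>det (b m)\<close> divided by \<open>det (mscale (c k m) (q k))\<close>.\<close>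
  define x where "x m = 1 + bil (h k m) (G *v h k m) / c k m" for m
  \<comment> \<open>If the ratios for \<open>i\<close> and \<open>k\<close> differ,
    \<open>x m\<close> is their quotient and \<open>x n\<close> its inverse.\<close>
  have pair: "bil (h k m) (G *v h k n) = 0 \<and> c i n * c k m * x m = c i m * c k n \<and> c i m * c k n * x n = c i n * c k m"
    if ne: "c i m * c k n \<noteq> c i n * c k m" for i m n
  proof -
    define D where "D = c i n * c k m - c i m * c k n"
    have "D \<noteq> 0" using ne by (simp add: D_def)
    have eq: "mscale (c k m) (q k) + outer (h k m) = mscale (c i m) (q i) + outer (h i m)" for m
      using b [of m k] b [of m i] by simp
    note orth = basket_pair_orthogonal [OF G eq eq c c D_def \<open>D \<noteq> 0\<close>]
    have "x m = 1 - D / c i n / c k m" "x n = 1 + D / c i m / c k n"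
      unfolding x_def orth by simp_all
    then show ?thesis using orth(1) c by (simp add: D_def field_simps)
  qed
  have x: "bil (h k m) (G *v h k n) = 0 \<and> x m * x n = 1 \<and> x m \<noteq> 1" if mn: "m \<noteq> n" for m n
  proof -
    obtain i where i: "c i m * c k n \<noteq> c i n * c k m" using nonprop [OF mn] by blast
    note p = pair [OF i]
    have "(c i n * c k m * (c i m * c k n)) * (x m * x n) = (c i n * c k m * x m) * (c i m * c k n * x n)"
      by simp
    also have "\<dots> = (c i n * c k m * (c i m * c k n)) * 1" using p by simp
    finally have "x m * x n = 1" using c by simp
    moreover have "x m \<noteq> 1" using p i by auto
    ultimately show ?thesis using p by simp
  qed
  have "x m \<noteq> 1" for m
  proof -
    obtain n where "n \<noteq> m" by (rule other_index)
    then show ?thesis using x [of m n] by simp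
  qed
  with x have x1: "x m = - 1" for m by (blast intro: all_minus_one_if_pairwise_inverse)
  show "bil (h k m) (G *v h k n) = (if m = n then - 2 * c k m else 0)"
  proof (cases "m = n")
    case True
    have "bil (h k m) (G *v h k m) / c k m = x m - 1" by (simp add: x_def)
    then have "bil (h k m) (G *v h k m) / c k m = - 2" by (simp add: x1)
    then show ?thesis using True c by (simp add: nonzero_divide_eq_eq)
  qed (use x in simp)
  show "c i m * c k n = c i n * c k m \<or> c i m * c k n = - (c i n * c k m)"
  proof (rule disjCI)
    assume "c i m * c k n \<noteq> - (c i n * c k m)"
    moreover have "c i n * c k m * x m = - (c i n * c k m)" by (simp add: x1)
    ultimately show "c i m * c k n = c i n * c k m" using pair [of i m n] by argo
  qed
qed

section \<open>Change of coordinates\<close>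

lemma matrix_inv_inverse:
  fixes P :: "complex ^ 4 ^ 4"
  assumes "invertible P"
  shows "P ** matrix_inv P = mat 1" "matrix_inv P ** P = mat 1"
proof -
  have "P ** matrix_inv P = mat 1 \<and> matrix_inv P ** P = mat 1"
    using assms unfolding invertible_def matrix_inv_def by (rule someI_ex)
  then show "P ** matrix_inv P = mat 1" "matrix_inv P ** P = mat 1" by simp_all
qed

lemma image_quadric_add: "image_quadric P (A + B) = image_quadric P A + image_quadric P B"
  by (simp add: image_quadric_def matrix_matrix_mult_def vec_eq_iff sum.distrib algebra_simps)

lemma image_quadric_mscale: "image_quadric P (mscale c A) = mscale c (image_quadric P A)"
  by (simp add: image_quadric_def mscale_def matrix_matrix_mult_def vec_eq_iff
      sum_distrib_left sum_distrib_right mult_ac)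

lemma image_quadric_outer: "image_quadric P (outer h) = outer (transpose (matrix_inv P) *v h)"
  unfolding image_quadric_def
  by (simp add: outer_def matrix_matrix_mult_def matrix_vector_mult_def vec_eq_iff transpose_def
      sum_product sum_distrib_left sum_distrib_right mult_ac)

lemma image_quadric_inverse:
  assumes "invertible P"
  shows "transpose P ** image_quadric P A ** P = A"
proof -
  have 1: "matrix_inv P ** P = mat 1" using assms by (rule matrix_inv_inverse(2))
  then have "transpose P ** transpose (matrix_inv P) = mat 1"
    by (metis matrix_transpose_mul transpose_mat)
  then show ?thesis
    using 1 unfolding image_quadric_def by (metis matrix_mul_assoc matrix_mul_lid matrix_mul_rid)
qed

lemma transpose_matrix_inv_ker:
  fixes P :: "complex ^ 4 ^ 4"
  assumes "invertible P" "transpose (matrix_inv P) *v h = 0"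
  shows "h = 0"
proof -
  have "transpose P ** transpose (matrix_inv P) = mat 1"
    using matrix_inv_inverse(2) [OF assms(1)] by (metis matrix_transpose_mul transpose_mat)
  then have "h = (transpose P ** transpose (matrix_inv P)) *v h" by simp
  also have "\<dots> = transpose P *v (transpose (matrix_inv P) *v h)"
    by (simp only: matrix_vector_mul_assoc)
  finally have "h = transpose P *v (transpose (matrix_inv P) *v h)" .
  then show ?thesis using assms(2) by simp
qed

text \<open>With the \<open>e m\<close> as columns of \<open>E\<close>, orthonormality reads
  \<open>transpose E ** (G ** E) = mat 1\<close>, whence \<open>A = E ** transpose E\<close>, and
  \<open>transpose E\<close> serves as \<open>P\<close>.\<close>

lemma orthonormal_frame_coordinates:
  assumes G: "A ** G = mat 1"
    and e: "\<And>m n. bil (e m) (G *v e n) = (if m = n then 1 else 0)"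
  obtains P where "invertible P" "image_quadric P A = mat 1"
    "\<And>m. transpose (matrix_inv P) *v e m = axis m 1"
proof -
  define E :: "complex ^ 4 ^ 4" where "E = (\<chi> i m. e m $ i)"
  have "(transpose E ** (G ** E)) $ m $ n = bil (e m) (G *v e n)" for m n
    by (simp add: E_def matrix_matrix_mult_def matrix_vector_mult_def bil_def transpose_def)
  then have 1: "transpose E ** (G ** E) = mat 1" by (simp add: e vec_eq_iff mat_def)
  then have inv: "invertible (transpose E)" unfolding invertible_right_inverse by blast
  have "(G ** E) ** transpose E = mat 1" using 1 by (rule iffD1 [OF matrix_left_right_inverse])
  then have "A ** (G ** E ** transpose E) = A" by simp
  then have "(A ** G) ** (E ** transpose E) = A" by (simp only: matrix_mul_assoc)
  then have A: "A = E ** transpose E" unfolding G by simp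
  define F where "F = matrix_inv (transpose E)"
  have F: "transpose E ** F = mat 1" unfolding F_def using inv by (rule matrix_inv_inverse(1))
  then have "transpose (transpose E ** F) = mat 1" by (simp add: transpose_mat)
  then have F': "transpose F ** E = mat 1" by (simp add: matrix_transpose_mul)
  have "image_quadric (transpose E) A = (transpose F ** E) ** (transpose E ** F)"
    unfolding image_quadric_def A F_def [symmetric] by (simp only: matrix_mul_assoc)
  then have "image_quadric (transpose E) A = mat 1" unfolding F F' by simp
  moreover have "transpose F *v e m = axis m 1" for m
  proof -
    have "e m = E *v axis m 1" by (simp add: matrix_vector_mult_def axis_def E_def vec_eq_iff if_distrib cong: if_cong)
    then show ?thesis by (simp add: matrix_vector_mul_assoc F')
  qed
  ultimately show thesis using inv that unfolding F_def by blast
qed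

section \<open>Recognising the quadrics of determinant 1\<close>

text \<open>
  Compares \<open>2 \<times> 2\<close> minors of the rank one matrices \<open>x x\<^sup>T\<close> and \<open>y y\<^sup>T\<close>, whose difference or sum is
  a known diagonal matrix.
\<close>

lemma rank_one_difference_support:
  fixes x y :: "4 \<Rightarrow> complex"
  assumes x: "\<And>i j. m * T i j + x i * x j = (if i = j then (if i = a then - 1 else 1) else 0)"
    and y: "\<And>i j. n * T i j + y i * y j = (if i = j then (if i = b then - 1 else 1) else 0)"
    and mn: "m = n \<or> m = - n" and ab: "a \<noteq> b" and i: "x i \<noteq> 0"
  shows "m = n \<longleftrightarrow> i = a \<or> i = b"
proof -
  have same: "x k = 0" if "m = n" "k \<noteq> a" "k \<noteq> b" for k
  proof -
    have "m * T a a + x a * x a = - 1" "m * T a a + y a * y a = 1"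
      "m * T k k + x k * x k = 1" "m * T k k + y k * y k = 1"
      "m * T a k + x a * x k = 0" "m * T a k + y a * y k = 0"
      using x [of a a] y [of a a] x [of k k] y [of k k] x [of a k] y [of a k] that ab by auto
    \<comment> \<open>Subtraction gives \<open>x a * x k = y a * y k\<close>,
      \<open>x k * x k = y k * y k\<close> and \<open>y a * y a = x a * x a + 2\<close>; square the
      first.\<close>
    then have "2 * (x k * x k) = 0" by algebra
    then show ?thesis by simp
  qed
  have opp: "x a = 0 \<and> x b = 0" if "m = - n"
  proof -
    obtain k where k: "k \<noteq> a" "k \<noteq> b" by (rule other_index)
    have "m * T a a + x a * x a = - 1" "- m * T a a + y a * y a = 1"
      "m * T b b + x b * x b = 1" "- m * T b b + y b * y b = - 1"
      "m * T k k + x k * x k = 1" "- m * T k k + y k * y k = 1"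
      "m * T a k + x a * x k = 0" "- m * T a k + y a * y k = 0"
      "m * T b k + x b * x k = 0" "- m * T b k + y b * y k = 0"
      using x [of a a] y [of a a] x [of k k] y [of k k] x [of a k] y [of a k]
        x [of b b] y [of b b] x [of b k] y [of b k] that ab k by auto
    \<comment> \<open>Addition gives \<open>x a * x k = - (y a * y k)\<close>,
      \<open>y a * y a = - (x a * x a)\<close> and \<open>y k * y k = 2 - x k * x k\<close>; square
      the first. The same works for \<open>b\<close>.\<close>
    then have "2 * (x a * x a) = 0" "2 * (x b * x b) = 0" by algebra+
    then show ?thesis by simp
  qed
  show ?thesis
  proof
    show "i = a \<or> i = b" if "m = n" using same [OF that] i by blast
    show "m = n" if "i = a \<or> i = b" using opp mn that i by blast
  qed
qed

text \<open>Each \<open>k m\<close> has a single nonzero coordinate \<open>p m\<close>. So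
  \<open>T\<close> is diagonal, and its entry at \<open>i\<close> is read off from any
  \<open>m\<close> with \<open>p m\<close> different from \<open>i\<close>. A fixed point of
  \<open>p\<close> leads to the sum of squares, its absence to two minus signs.\<close>

lemma common_basket_std_group_pos:
  fixes T :: "complex ^ 4 ^ 4"
  assumes T: "\<And>m. diag (\<chi> j. if j = m then - 1 else 1) = mscale (c m) T + outer (k m)"
    and k: "\<And>m. k m \<noteq> 0" and c: "\<And>m. c m \<noteq> 0"
    and signs: "\<And>m n. c m = c n \<or> c m = - c n"
  shows "quadric_pt T \<in> std_group 1"
proof -
  have entry: "c m * T $ i $ j + k m $ i * k m $ j = (if i = j then (if i = m then - 1 else 1) else 0)"
    for m i j
  proof -
    have "diag (\<chi> j. if j = m then - 1 else 1) $ i $ j = c m * T $ i $ j + k m $ i * k m $ j"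
      unfolding T by (simp add: mscale_def outer_def)
    then show ?thesis unfolding diag_def vec_lambda_beta by (rule sym)
  qed
  have supp: "c m = c n \<longleftrightarrow> i = m \<or> i = n" if "m \<noteq> n" "k m $ i \<noteq> 0" for m n i
    using rank_one_difference_support [of "c m" "\<lambda>i j. T $ i $ j" "\<lambda>i. k m $ i" m "c n" "\<lambda>i. k n $ i" n i]
      entry signs that by blast
  have unique: "i = j" if "k m $ i \<noteq> 0" "k m $ j \<noteq> 0" for m i j
  proof (rule ccontr)
    assume ij: "i \<noteq> j"
    \<comment> \<open>If \<open>m\<close> is \<open>i\<close> or \<open>j\<close>, this
      \<open>n\<close> contradicts \<open>supp\<close>; otherwise \<open>i\<close> in the role of
      \<open>n\<close> does.\<close>
    obtain n where "n \<noteq> m" "n \<noteq> i" "n \<noteq> j" by (rule other_index)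
    then show False using supp that ij by metis
  qed
  have "\<exists>i. k m $ i \<noteq> 0" for m using k [of m] by (auto simp: vec_eq_iff)
  then obtain p where p: "\<And>m. k m $ p m \<noteq> 0" by metis
  have zero: "k m $ i = 0" if "i \<noteq> p m" for m i using unique p that by blast
  have off: "T $ i $ j = 0" if "i \<noteq> j" for i j
  proof -
    have "k 1 $ i * k 1 $ j = 0" using unique [of 1 i j] that by auto
    then show ?thesis using entry [of 1 i j] that c by auto
  qed
  have on: "T $ i $ i = (if i = m then - 1 else 1) / c m" if "i \<noteq> p m" for m i
    using entry [of m i i] zero [OF that] c [of m] by (simp add: field_simps)
  show ?thesis
  proof (cases "\<exists>m. p m = m")
    case True
    then obtain m where m: "p m = m" by blast
    have c_m: "c n = c m" for n using supp [of m n "p m"] p m by metis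
    have T1: "T $ i $ i = 1 / c m" for i
    proof -
      obtain n where n: "n \<noteq> i" by (rule other_index)
      have "p n = n"
      proof -
        \<comment> \<open>\<open>p n\<close> lies in both \<open>{n, i}\<close> and
          \<open>{n, l}\<close>.\<close>
        obtain l where "l \<noteq> n" "l \<noteq> i" by (rule other_index)
        then show ?thesis using supp [of n i "p n"] supp [of n l "p n"] p c_m n by metis
      qed
      then show ?thesis using on [of i n] n c_m [of n] by simp
    qed
    have "T = mscale (1 / c m) (diag (\<chi> j. 1))"
      using T1 off by (simp add: vec_eq_iff mscale_def diag_def)
    then have "quadric_pt T = quadric_pt (diag (\<chi> j. 1))" using c by (simp add: quadric_pt_mscale)
    then show ?thesis unfolding std_group_pos by blast
  next
    case False
    define a where "a = p 1"
    have a: "a \<noteq> 1" using False by (auto simp: a_def)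
    have ca: "c a = c 1" using supp [of 1 a a] p [of 1] a by (auto simp: a_def)
    have "p a = 1" using supp [of a 1 "p a"] p [of a] ca a False by metis
    then have T1: "T $ 1 $ 1 = - 1 / c 1" "T $ a $ a = - 1 / c 1"
      using on [of 1 1] on [of a a] a ca by (simp_all add: a_def)
    have Ti: "T $ i $ i = 1 / c 1" if "i \<noteq> 1" "i \<noteq> a" for i
      using on [of i 1] that by (simp add: a_def)
    have "T = mscale (1 / c 1) (diag (\<chi> j. if j = 1 \<or> j = a then - 1 else 1))"
      using T1 Ti off by (auto simp: vec_eq_iff mscale_def diag_def)
    then have "quadric_pt T = quadric_pt (diag (\<chi> j. if j = 1 \<or> j = a then - 1 else 1))"
      using c by (simp add: quadric_pt_mscale)
    moreover have "a \<in> {2, 3, 4}" using exhaust_4 [of a] a by auto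
    ultimately show ?thesis unfolding std_group_pos by blast
  qed
qed

section \<open>Construction of the projective automorphism\<close>

theorem theorem5p1:
  fixes q b :: "4 \<Rightarrow> complex ^ 4 ^ 4"
  assumes "\<And>i. smooth_quadric (q i)"
    and "\<And>\<alpha>. smooth_quadric (b \<alpha>)"
    and "double_four q b"
  shows "\<exists>P. invertible P \<and>
    (let Q = range (\<lambda>i. quadric_pt (image_quadric P (q i)));
         B = range (\<lambda>\<alpha>. quadric_pt (image_quadric P (b \<alpha>)))
     in (Q = std_group (- 1) \<and> B = std_group 1) \<or> (Q = std_group 1 \<and> B = std_group (- 1)))"
proof -
  have indep: "lin_indep q" and bas: "\<And>i m. basket (q i) (b m)"
    and inj_b: "inj (\<lambda>m. quadric_pt (b m))" and inj_q: "inj (\<lambda>i. quadric_pt (q i))"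
    using assms(3) by (auto simp: double_four_def common_basket_def)
  have "\<forall>i m. \<exists>c h. c \<noteq> 0 \<and> h \<noteq> 0 \<and> b m = mscale c (q i) + outer h"
    using basket_decomposition [OF assms(1,2) bas] by blast
  then have "\<exists>c h. \<forall>i m. c i m \<noteq> 0 \<and> h i m \<noteq> 0 \<and> b m = mscale (c i m) (q i) + outer (h i m)"
    by (simp only: choice_iff)
  then obtain c h where c: "\<And>i m. c i m \<noteq> 0" and h: "\<And>i m. h i m \<noteq> 0"
    and b: "\<And>i m. b m = mscale (c i m) (q i) + outer (h i m)" by blast
  have nonprop: "\<exists>i. c i m * c 1 n \<noteq> c i n * c 1 m" if "m \<noteq> n" for m n
  proof (rule ccontr)
    assume "\<not> ?thesis"
    then have eq: "c i m * c 1 n = c i n * c 1 m" for i by blast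
    have ratio: "c i m = c 1 m / c 1 n * c i n" for i
      using eq [of i] c [of 1 n] by (simp add: nonzero_eq_divide_eq mult.commute [of "c 1 m"])
    have "b m = mscale (c 1 m / c 1 n * c i n) (q i) + outer (h i m)" for i
      using b [of m i] unfolding ratio [of i] .
    then have "b m = mscale (c 1 m / c 1 n) (b n)"
      by (rule proportional_scalars_imp_proportional [OF indep c _ b]) (simp add: c)
    then have "quadric_pt (b m) = quadric_pt (b n)" using c by (simp add: quadric_pt_mscale)
    then show False using inj_b that by (auto dest: injD)
  qed
  define G where "G = matrix_inv (q 1)"
  have G: "q 1 ** G = mat 1"
    unfolding G_def using smooth_quadric_invertible [OF assms(1)] by (rule matrix_inv_inverse(1))
  note orth = baskets_orthogonal [of q 1 G b c h, OF G b c nonprop]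
  \<comment> \<open>Since \<open>h 1 m\<close> pairs with itself under \<open>G\<close> to
    \<open>- 2 * c 1 m\<close>, division by \<open>r m\<close> makes the frame orthonormal.\<close>
  define r where "r m = csqrt (- 2 * c 1 m)" for m
  have r: "r m * r m = - 2 * c 1 m" "r m \<noteq> 0" for m
    using c by (simp_all add: r_def flip: power2_eq_square)
  define e where "e m = (1 / r m) *s h 1 m" for m
  have "bil (e m) (G *v e n) = (if m = n then 1 else 0)" for m n
  proof -
    have "bil (e m) (G *v e n) = (if m = n then - 2 * c 1 m else 0) / (r m * r n)"
      by (simp add: e_def vector_scalar_commute orth(1))
    then show ?thesis unfolding r(1) [symmetric] using r(2) by simp
  qed
  then obtain P where P: "invertible P" "image_quadric P (q 1) = mat 1"
    "\<And>m. transpose (matrix_inv P) *v e m = axis m 1"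
    using orthonormal_frame_coordinates [OF G, of e] by blast
  have "transpose (matrix_inv P) *v h 1 m = r m *s axis m 1" for m
  proof -
    have "h 1 m = r m *s e m" using r by (simp add: e_def vector_smult_assoc)
    then show ?thesis by (simp only: vector_scalar_commute P(3))
  qed
  then have "image_quadric P (b m) = mscale (c 1 m) (mat 1) + outer (r m *s axis m 1)" for m
    by (subst b [of m 1]) (simp add: image_quadric_add image_quadric_mscale image_quadric_outer P
        del: transpose_matrix_vector)
  also have "mscale (c 1 m) (mat 1) + outer (r m *s axis m 1) =
      mscale (c 1 m) (diag (\<chi> j. if j = m then - 1 else 1))" for m
    using r(1) [of m] by (auto simp: vec_eq_iff mscale_def mat_def outer_def diag_def axis_def)
  finally have image_b: "image_quadric P (b m) = mscale (c 1 m) (diag (\<chi> j. if j = m then - 1 else 1))"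
    for m .
  then have B: "range (\<lambda>m. quadric_pt (image_quadric P (b m))) = std_group (- 1)"
    unfolding std_group_neg using c by (simp add: quadric_pt_mscale)
  have mem: "quadric_pt (image_quadric P (q i)) \<in> std_group 1" for i
  proof (rule common_basket_std_group_pos)
    \<comment> \<open>Dividing the image of \<open>b m\<close> by \<open>c 1 m\<close> gives the
      standard matrix; the square root carries this division into the rank one term.\<close>
    define k where "k m = (1 / csqrt (c 1 m)) *s (transpose (matrix_inv P) *v h i m)" for m
    show "diag (\<chi> j. if j = m then - 1 else 1) = mscale (c i m / c 1 m) (image_quadric P (q i)) + outer (k m)"
      for m
    proof -
      have "diag (\<chi> j. if j = m then - 1 else 1) = mscale (1 / c 1 m) (image_quadric P (b m))"
        unfolding image_b using c by (simp add: mscale_def vec_eq_iff)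
      also have "\<dots> = mscale (c i m / c 1 m) (image_quadric P (q i))
          + mscale (1 / c 1 m) (outer (transpose (matrix_inv P) *v h i m))"
        unfolding b [of m i] image_quadric_add image_quadric_mscale image_quadric_outer
        by (simp add: mscale_def vec_eq_iff algebra_simps)
      also have "mscale (1 / c 1 m) (outer (transpose (matrix_inv P) *v h i m)) = outer (k m)"
        by (simp add: k_def outer_def mscale_def vec_eq_iff flip: power2_eq_square)
      finally show ?thesis .
    qed
    show "k m \<noteq> 0" for m
      using transpose_matrix_inv_ker [OF P(1)] h c by (auto simp: k_def)
    show "c i m / c 1 m \<noteq> 0" for m using c by simp
    show "c i m / c 1 m = c i n / c 1 n \<or> c i m / c 1 m = - (c i n / c 1 n)" for m n
      using orth(2) [of i m n] c by (simp add: field_simps)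
  qed
  \<comment> \<open>Four distinct members exhaust \<open>std_group 1\<close>, which has at most four
    elements.\<close>
  have "inj (\<lambda>i. quadric_pt (image_quadric P (q i)))"
  proof (rule injI)
    fix i j assume "quadric_pt (image_quadric P (q i)) = quadric_pt (image_quadric P (q j))"
    then obtain d where d: "d \<noteq> 0" "image_quadric P (q i) = mscale d (image_quadric P (q j))"
      by (rule quadric_pt_eqD)
    then have "image_quadric P (q i) = image_quadric P (mscale d (q j))"
      by (simp add: image_quadric_mscale)
    then have "q i = mscale d (q j)" using image_quadric_inverse [OF P(1)] by metis
    then have "quadric_pt (q i) = quadric_pt (q j)" using d(1) by (simp add: quadric_pt_mscale)
    then show "i = j" using inj_q by (auto dest: injD)
  qed
  then have card: "card (range (\<lambda>i. quadric_pt (image_quadric P (q i)))) = 4"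
    by (simp add: card_image)
  have fin: "finite (std_group 1)" unfolding std_group_pos by simp
  have "card (std_group 1) \<le> Suc (card ((\<lambda>k. quadric_pt (diag (\<chi> j. if j = 1 \<or> j = k then - 1 else 1))) ` {2, 3, 4 :: 4}))"
    unfolding std_group_pos by (rule card_insert_le_m1) simp_all
  also have "\<dots> \<le> Suc (card {2, 3, 4 :: 4})" by (intro le_SucI Suc_le_mono [THEN iffD2] card_image_le) simp
  also have "\<dots> \<le> 4" by simp
  finally have "range (\<lambda>i. quadric_pt (image_quadric P (q i))) = std_group 1"
    using mem card by (intro card_seteq [OF fin]) auto
  with P(1) B show ?thesis unfolding Let_def by blast
qed

end
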